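(* Consider the mixed even $p$-spin short-range model on a hypergraph $G=([N],E)$ (all hyperedges have an even number of vertices). Let $t\ge 0$ and $\beta\in[0,\infty]$. Then, for both the continuous and the discrete perturbation and for any $r\in\mathbb Z_+=\{0,1,2,\dots\}$, $$\mathbb E\langle R(\sigma,\tau)^2\rangle_t\le \frac1N\max_{i\in[N]}|B_r(i)|+e^{-tr}.$$ In particular: 1. (Polynomial growth) If there are positive constants $A,\theta$ independent of $N$ such that $\max_{i\in[N]}|B_r(i)|\le A r^\theta$ for all $r\in\mathbb N=\{1,2,\dots\}$, then for any $t>0$ and $\beta\in[0,\infty]$, $$\mathbb E\langle R(\sigma,\tau)^2\rangle_t\le\frac1N+\frac{C}{N t^\theta}$$ for some constant $C>0$ depending only on $A$ and $\theta$. 2. (Exponential growth) If there are constants $A$ and $\gamma>1$ independent of $N$ such that $\max_{i\in[N]}|B_r(i)|\le A\gamma^r$ for all $r\in\mathbb N$, then for any $t>0$ and $\beta\in[0,\infty]$, $$\mathbb E\langle R(\sigma,\tau)^2\rangle_t\le \frac{C}{N^{t/(t+\log\gamma)}}$$ for some constant $C>0$ depending only on $A$ and $\gamma$.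
   Context: Hypergraph: Let $\Delta\ge2$ be an integer and $G=([N],E)$ a hypergraph with $E=\bigcup_{2\le p\le\Delta}E_p$, where $E_p\subseteq\binom{[N]}{p}$ is a set of $p$-element subsets of $[N]$; $V(e)\subseteq[N]$ denotes the vertex set of the hyperedge $e$. In the mixed even $p$-spin short-range model, $E_p=\emptyset$ for odd $p$. Distance: a (Berge) path of length $\ell\in\mathbb N$ from $v_1$ to $v_{\ell+1}$ is a sequence $(v_1,e_1,v_2,\dots,v_\ell,e_\ell,v_{\ell+1})$ of $\ell+1$ distinct vertices and $\ell$ distinct hyperedges with $\{v_k,v_{k+1}\}\subseteq V(e_k)$ for all $k$. $d(v,v')$ is the minimal length of a path from $v$ to $v'$ if $v\ne v'$ ($\infty$ if there is none), and $d(v,v)=0$. $B_r(v)=\{v'\in[N]:d(v,v')\le r\}$. Model: $(J_e)_{e\in E}$ are i.i.d. standard Gaussians; for each $2\le p\le\Delta$, $\rho_p:\mathbb R\to\mathbb R$ is an odd measurable function. With $\sigma_e=\prod_{i\in V(e)}\sigma_i$, the Hamiltonian is $H_J(\sigma)=\sum_{2\le p\le\Delta}\sum_{e\in E_p}\rho_p(J_e)\sigma_e$ for $\sigma\in\{\pm1\}^N$. For $\beta<\infty$ the Gibbs measure on $\{\pm1\}^N$ is $G_{J,\beta}(\sigma)\propto e^{\beta H_J(\sigma)}$; for $\beta=\infty$ it is the uniform measure on the set of maximizers of $H_J$ (ground states). Perturbations: let $J'=(J'_e)_{e\in E}$ be an independent copy of $J$. Continuous perturbation: $J_e(t)=e^{-t}J_e+\sqrt{1-e^{-2t}}\,J'_e$.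 Discrete perturbation: $J_e(t)=B_eJ_e+(1-B_e)J'_e$ with $B_e$ i.i.d. Bernoulli with $\mathbb P(B_e=1)=e^{-t}$, independent of $J,J'$. Overlap: $R(\sigma,\tau)=\frac1N\sum_{i=1}^N\sigma_i\tau_i$. $\langle\cdot\rangle_t$ is the expectation over $(\sigma,\tau)$ drawn from the product measure $G_{J,\beta}\otimes G_{J(t),\beta}$ (given $J,J(t)$), and $\mathbb E$ is the expectation over the disorder (and over the $B_e$). *)

theory Defs
  imports "HOL-Probability.Probability"
begin

text \<open>A hypergraph on \<open>[N] = {1..N}\<close> is given by its set \<open>E\<close> of hyperedges; a hyperedge is
  identified with its vertex set, so \<open>V(e)\<close> is \<open>e\<close> itself.\<close>

type_synonym hyperedge = "nat set"

definition layer :: "hyperedge set \<Rightarrow> nat \<Rightarrow> hyperedge set" where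
  "layer E p = {e \<in> E. card e = p}"

definition hypergraph :: "nat \<Rightarrow> nat \<Rightarrow> hyperedge set \<Rightarrow> bool" where
  "hypergraph N \<Delta> E \<longleftrightarrow> (\<forall>e\<in>E. e \<subseteq> {1..N}) \<and> E = (\<Union>p\<in>{2..\<Delta>}. layer E p)"

text \<open>\<open>vs\<close> lists the vertices \<open>v\<^sub>1, \<dots>, v\<^bsub>l+1\<^esub>\<close> and \<open>es\<close> the hyperedges \<open>e\<^sub>1, \<dots>, e\<^sub>l\<close> of the path.\<close>

definition berge_path ::
  "nat \<Rightarrow> hyperedge set \<Rightarrow> nat \<Rightarrow> nat \<Rightarrow> nat \<Rightarrow> nat list \<Rightarrow> hyperedge list \<Rightarrow> bool" where
  "berge_path N E l v v' vs es \<longleftrightarrow>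
     1 \<le> l \<and> length es = l \<and> length vs = Suc l \<and>
     set vs \<subseteq> {1..N} \<and> set es \<subseteq> E \<and> distinct vs \<and> distinct es \<and>
     vs ! 0 = v \<and> vs ! l = v' \<and>
     (\<forall>k<l. {vs ! k, vs ! Suc k} \<subseteq> es ! k)"

text \<open>The infimum of the empty set is \<open>\<infinity>\<close> in \<open>enat\<close>.\<close>

definition hdist :: "nat \<Rightarrow> hyperedge set \<Rightarrow> nat \<Rightarrow> nat \<Rightarrow> enat" where
  "hdist N E v v' =
     (if v = v' then 0 else Inf {enat l | l. \<exists>vs es. berge_path N E l v v' vs es})"

definition hball :: "nat \<Rightarrow> hyperedge set \<Rightarrow> nat \<Rightarrow> nat \<Rightarrow> nat set" where
  "hball N E r v = {v' \<in> {1..N}. hdist N E v v' \<le> enat r}"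

definition max_ball_card :: "nat \<Rightarrow> hyperedge set \<Rightarrow> nat \<Rightarrow> nat" where
  "max_ball_card N E r = Max ((\<lambda>i. card (hball N E r i)) ` {1..N})"

type_synonym disorder = "hyperedge \<Rightarrow> real"
type_synonym spins = "nat \<Rightarrow> real"

definition mixed_even_model ::
  "nat \<Rightarrow> nat \<Rightarrow> hyperedge set \<Rightarrow> (nat \<Rightarrow> real \<Rightarrow> real) \<Rightarrow> bool" where
  "mixed_even_model N \<Delta> E \<rho> \<longleftrightarrow>
     1 \<le> N \<and> 2 \<le> \<Delta> \<and> hypergraph N \<Delta> E \<and>
     (\<forall>p. odd p \<longrightarrow> layer E p = {}) \<and>
     (\<forall>p\<in>{2..\<Delta>}. \<rho> p \<in> borel_measurable borel \<and> (\<forall>x. \<rho> p (- x) = - \<rho> p x))"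

definition configs :: "nat \<Rightarrow> spins set" where
  "configs N = {1..N} \<rightarrow>\<^sub>E {-1, 1}"

definition hamiltonian ::
  "nat \<Rightarrow> hyperedge set \<Rightarrow> (nat \<Rightarrow> real \<Rightarrow> real) \<Rightarrow> disorder \<Rightarrow> spins \<Rightarrow> real" where
  "hamiltonian \<Delta> E \<rho> J \<sigma> = (\<Sum>p\<in>{2..\<Delta>}. \<Sum>e\<in>layer E p. \<rho> p (J e) * (\<Prod>i\<in>e. \<sigma> i))"

definition ground_states :: "nat \<Rightarrow> (spins \<Rightarrow> real) \<Rightarrow> spins set" where
  "ground_states N H = {\<sigma> \<in> configs N. \<forall>\<tau>\<in>configs N. H \<tau> \<le> H \<sigma>}"

text \<open>Probability mass assigned to a configuration by the Gibbs measure; the inverse temperature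
  ranges over \<open>[0, \<infinity>]\<close>, i.e. over the type \<open>ennreal\<close>.\<close>

definition gibbs :: "nat \<Rightarrow> ennreal \<Rightarrow> (spins \<Rightarrow> real) \<Rightarrow> spins \<Rightarrow> real" where
  "gibbs N \<beta> H \<sigma> =
     (if \<beta> = \<infinity>
      then (if \<sigma> \<in> ground_states N H then 1 / real (card (ground_states N H)) else 0)
      else exp (enn2real \<beta> * H \<sigma>) / (\<Sum>\<tau>\<in>configs N. exp (enn2real \<beta> * H \<tau>)))"

definition overlap :: "nat \<Rightarrow> spins \<Rightarrow> spins \<Rightarrow> real" where
  "overlap N \<sigma> \<tau> = (\<Sum>i\<in>{1..N}. \<sigma> i * \<tau> i) / real N"

definition gibbs_avg2 ::
  "nat \<Rightarrow> ennreal \<Rightarrow> (spins \<Rightarrow> real) \<Rightarrow> (spins \<Rightarrow> real) \<Rightarrow> (spins \<Rightarrow> spins \<Rightarrow> real) \<Rightarrow> real" where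
  "gibbs_avg2 N \<beta> H H' f =
     (\<Sum>\<sigma>\<in>configs N. \<Sum>\<tau>\<in>configs N. gibbs N \<beta> H \<sigma> * gibbs N \<beta> H' \<tau> * f \<sigma> \<tau>)"

text \<open>The variables \<open>J\<close>, \<open>J'\<close>, \<open>B\<close> are realized on the canonical product space. The expectations
  below depend only on their joint law, so nothing is lost compared with an arbitrary
  probability space, and constants cannot depend on the choice of the space.\<close>

datatype perturbation = Continuous | Discrete

definition gaussian_disorder :: "hyperedge set \<Rightarrow> disorder measure" where
  "gaussian_disorder E = PiM E (\<lambda>_. std_normal_distribution)"

definition bernoulli_mask :: "hyperedge set \<Rightarrow> real \<Rightarrow> (hyperedge \<Rightarrow> bool) measure" where
  "bernoulli_mask E t = PiM E (\<lambda>_. measure_pmf (bernoulli_pmf (exp (- t))))"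

text \<open>\<open>disorder_expectation K E t F\<close> is the expectation of \<open>F J (J(t))\<close>.\<close>

fun disorder_expectation ::
  "perturbation \<Rightarrow> hyperedge set \<Rightarrow> real \<Rightarrow> (disorder \<Rightarrow> disorder \<Rightarrow> real) \<Rightarrow> real" where
  "disorder_expectation Continuous E t F =
     (\<integral>(J, J'). F J (\<lambda>e. exp (- t) * J e + sqrt (1 - exp (- 2 * t)) * J' e)
        \<partial>(gaussian_disorder E \<Otimes>\<^sub>M gaussian_disorder E))"
| "disorder_expectation Discrete E t F =
     (\<integral>(J, J', B). F J (\<lambda>e. of_bool (B e) * J e + (1 - of_bool (B e)) * J' e)
        \<partial>(gaussian_disorder E \<Otimes>\<^sub>M (gaussian_disorder E \<Otimes>\<^sub>M bernoulli_mask E t)))"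

definition mean_sq_overlap ::
  "perturbation \<Rightarrow> nat \<Rightarrow> nat \<Rightarrow> hyperedge set \<Rightarrow> (nat \<Rightarrow> real \<Rightarrow> real) \<Rightarrow> ennreal \<Rightarrow> real \<Rightarrow> real"
where
  "mean_sq_overlap K N \<Delta> E \<rho> \<beta> t =
     disorder_expectation K E t
       (\<lambda>J Jt. gibbs_avg2 N \<beta> (hamiltonian \<Delta> E \<rho> J) (hamiltonian \<Delta> E \<rho> Jt)
                 (\<lambda>\<sigma> \<tau>. (overlap N \<sigma> \<tau>)\<^sup>2))"

end

theory Submission
  imports Defs
begin

text \<open>Expanding the squared overlap reduces everything to the correlations
  \<open>U(t) = \<bbbE> f(J) f(J(t))\<close> of \<open>f(J) = \<langle>\<sigma>\<^sub>i\<sigma>\<^sub>j\<rangle>\<close>. If a set \<open>S\<close> of fewer than \<open>d(i, j)\<close> hyperedges is given,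
  its component of \<open>i\<close> misses \<open>j\<close>; flipping the spins of that component together with the couplings
  that cross it leaves the couplings in \<open>S\<close> and the law of \<open>J\<close> unchanged (hyperedges are even,
  \<open>\<rho>\<^sub>p\<close> is odd) and changes the sign of \<open>f\<close>. Hence in the expansion of the joint law of \<open>(J, J(t))\<close>
  around independence only sets of at least \<open>d(i, j)\<close> hyperedges contribute, which gives
  \<open>U(t) \<le> C e\<^sup>-\<^sup>t\<^sup>d\<close> for large \<open>t\<close> with some \<open>C\<close>. Both dynamics are reversible semigroups, so
  \<open>U(t)\<^sup>2 \<le> U(2t)\<close>, and iterating this removes \<open>C\<close>.\<close>

section \<open>Finite product measures\<close>

text \<open>Couplings at different hyperedges are independent, so the joint law of
  \<open>(J, J(t))\<close> is a power of a law on pairs of reals with parameter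
  \<open>a = exp (- t)\<close>, and doubling the time squares \<open>a\<close>. A spectral proof
  would decompose \<open>f\<close> (Hermite functions, or projections indexed by sets of hyperedges)
  and read off the rate. Squaring replaces the decomposition: only the order of the bound as
  \<open>a\<close> tends to 0 matters, and a factor exponential in \<open>card E\<close> is harmless
  because the iteration removes it. The two dynamics differ in kind. The Ornstein-Uhlenbeck pair has
  a density with respect to the independent pair, but this density minus 1 changes sign. The
  resampled pair charges the diagonal, so it has no such density, but it is a mixture with an
  independent pair. \<open>correlation_decay\<close> covers both by working on an auxiliary space
  \<open>\<Omega>\<close> per hyperedge, with a weight split into \<open>k0\<close>, under which a
  sign flip of the first coupling is invisible to the second, and a remainder \<open>k1\<close> of
  mass of order \<open>a\<close>.\<close>

lemma distr_PiM_map: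
  assumes I: "finite I"
    and M: "\<And>i. prob_space (M i)"
    and h [measurable]: "\<And>i. h i \<in> M i \<rightarrow>\<^sub>M N i"
  shows "distr (PiM I M) (PiM I N) (\<lambda>x. \<lambda>i\<in>I. h i (x i)) = PiM I (\<lambda>i. distr (M i) (N i) (h i))"
proof -
  interpret D: product_prob_space "\<lambda>i. distr (M i) (N i) (h i)"
    by (intro product_prob_spaceI prob_space.prob_space_distr M h)
  interpret M: product_prob_space M
    by (intro product_prob_spaceI M)
  show ?thesis
  proof (rule D.PiM_eqI[OF I])
    show "sets (distr (PiM I M) (PiM I N) (\<lambda>x. \<lambda>i\<in>I. h i (x i)))
        = sets (PiM I (\<lambda>i. distr (M i) (N i) (h i)))"
      by (simp cong: sets_PiM_cong)
    fix A assume A: "\<And>i. i \<in> I \<Longrightarrow> A i \<in> sets (distr (M i) (N i) (h i))"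
    have meas [measurable]: "(\<lambda>x. \<lambda>i\<in>I. h i (x i)) \<in> PiM I M \<rightarrow>\<^sub>M PiM I N"
      by measurable
    have A': "\<And>i. i \<in> I \<Longrightarrow> A i \<in> sets (N i)" using A by simp
    have "emeasure (distr (PiM I M) (PiM I N) (\<lambda>x. \<lambda>i\<in>I. h i (x i))) (PiE I A)
        = emeasure (PiM I M) ((\<lambda>x. \<lambda>i\<in>I. h i (x i)) -` PiE I A \<inter> space (PiM I M))"
      by (rule emeasure_distr[OF meas]) (use A' I in \<open>auto intro!: sets_PiM_I_finite\<close>)
    also have "(\<lambda>x. \<lambda>i\<in>I. h i (x i)) -` PiE I A \<inter> space (PiM I M)
        = PiE I (\<lambda>i. h i -` A i \<inter> space (M i))"
      by (auto simp: space_PiM PiE_iff)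
    also have "emeasure (PiM I M) \<dots> = (\<Prod>i\<in>I. emeasure (M i) (h i -` A i \<inter> space (M i)))"
      by (rule M.emeasure_PiM[OF I]) (use A' h in \<open>auto intro: measurable_sets\<close>)
    also have "\<dots> = (\<Prod>i\<in>I. emeasure (distr (M i) (N i) (h i)) (A i))"
      by (intro prod.cong refl emeasure_distr[symmetric] h A')
    finally show "emeasure (distr (PiM I M) (PiM I N) (\<lambda>x. \<lambda>i\<in>I. h i (x i))) (PiE I A)
        = (\<Prod>i\<in>I. emeasure (distr (M i) (N i) (h i)) (A i))" .
  qed
qed

lemma nn_integral_PiM_PiM_prod:
  assumes I: "finite I"
    and M: "prob_space M" and N: "prob_space N"
    and g [measurable]: "\<And>i. i \<in> I \<Longrightarrow> case_prod (g i) \<in> borel_measurable (M \<Otimes>\<^sub>M N)"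
  shows "(\<integral>\<^sup>+x. \<integral>\<^sup>+y. (\<Prod>i\<in>I. g i (x i) (y i)) \<partial>PiM I (\<lambda>_. N) \<partial>PiM I (\<lambda>_. M))
    = (\<Prod>i\<in>I. \<integral>\<^sup>+x. \<integral>\<^sup>+y. g i x y \<partial>N \<partial>M)"
proof -
  interpret M: prob_space M by fact
  interpret N: prob_space N by fact
  interpret PM: product_prob_space "\<lambda>_. M" by (intro product_prob_spaceI M)
  interpret PN: product_prob_space "\<lambda>_. N" by (intro product_prob_spaceI N)
  have "(\<integral>\<^sup>+x. \<integral>\<^sup>+y. (\<Prod>i\<in>I. g i (x i) (y i)) \<partial>PiM I (\<lambda>_. N) \<partial>PiM I (\<lambda>_. M))
      = (\<integral>\<^sup>+x. (\<Prod>i\<in>I. \<integral>\<^sup>+y. g i (x i) y \<partial>N) \<partial>PiM I (\<lambda>_. M))"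
  proof (rule nn_integral_cong, rule PN.product_nn_integral_prod[OF I])
    fix x i assume "x \<in> space (PiM I (\<lambda>_. M))" and i: "i \<in> I"
    then have [simp]: "x i \<in> space M" by (auto simp: space_PiM)
    show "g i (x i) \<in> borel_measurable N"
      using measurable_compose[OF measurable_Pair1' g[OF i], of "x i"] by simp
  qed
  also have "\<dots> = (\<Prod>i\<in>I. \<integral>\<^sup>+x. \<integral>\<^sup>+y. g i x y \<partial>N \<partial>M)"
    by (rule PM.product_nn_integral_prod[OF I]) measurable
  finally show ?thesis .
qed

text \<open>The expectations are taken over separate families \<open>J\<close>, \<open>J'\<close>,
  \<open>B\<close>, while \<open>pair_corr\<close> uses one family of pairs; this regrouping by
  hyperedge translates between the two.\<close>

lemma distr_PiM_pair_zip:
  assumes I: "finite I" and M: "prob_space M" and N: "prob_space N"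
  shows "distr (PiM I (\<lambda>_. M) \<Otimes>\<^sub>M PiM I (\<lambda>_. N)) (PiM I (\<lambda>_. M \<Otimes>\<^sub>M N))
      (\<lambda>(x, y). \<lambda>i\<in>I. (x i, y i)) = PiM I (\<lambda>_. M \<Otimes>\<^sub>M N)"
proof -
  interpret M: prob_space M by fact
  interpret N: prob_space N by fact
  interpret MN: pair_prob_space M N ..
  interpret P: product_prob_space "\<lambda>_. M \<Otimes>\<^sub>M N"
    by (intro product_prob_spaceI) unfold_locales
  interpret PN: prob_space "PiM I (\<lambda>_. N)" by (intro prob_space_PiM N)
  have zip [measurable]: "(\<lambda>(x, y). \<lambda>i\<in>I. (x i, y i))
      \<in> PiM I (\<lambda>_. M) \<Otimes>\<^sub>M PiM I (\<lambda>_. N) \<rightarrow>\<^sub>M PiM I (\<lambda>_. M \<Otimes>\<^sub>M N)"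
    by measurable
  show ?thesis
  proof (rule P.PiM_eqI[OF I])
    fix A :: "_ \<Rightarrow> ('b \<times> 'c) set"
    assume A: "\<And>i. i \<in> I \<Longrightarrow> A i \<in> sets (M \<Otimes>\<^sub>M N)"
    have [measurable]: "PiE I A \<in> sets (PiM I (\<lambda>_. M \<Otimes>\<^sub>M N))"
      by (rule sets_PiM_I_finite[OF I A])
    have "emeasure (distr (PiM I (\<lambda>_. M) \<Otimes>\<^sub>M PiM I (\<lambda>_. N)) (PiM I (\<lambda>_. M \<Otimes>\<^sub>M N))
        (\<lambda>(x, y). \<lambda>i\<in>I. (x i, y i))) (PiE I A)
      = (\<integral>\<^sup>+x. \<integral>\<^sup>+y. indicator (PiE I A) (\<lambda>i\<in>I. (x i, y i)) \<partial>PiM I (\<lambda>_. N) \<partial>PiM I (\<lambda>_. M))"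
    proof -
      let ?P = "PiM I (\<lambda>_. M) \<Otimes>\<^sub>M PiM I (\<lambda>_. N)" and ?z = "\<lambda>(x, y). \<lambda>i\<in>I. (x i, y i)"
      have "emeasure (distr ?P (PiM I (\<lambda>_. M \<Otimes>\<^sub>M N)) ?z) (PiE I A)
          = (\<integral>\<^sup>+z. indicator (PiE I A) z \<partial>distr ?P (PiM I (\<lambda>_. M \<Otimes>\<^sub>M N)) ?z)"
        by simp
      also have "\<dots> = (\<integral>\<^sup>+p. indicator (PiE I A) (?z p) \<partial>?P)"
        by (rule nn_integral_distr) measurable
      also have "\<dots> = (\<integral>\<^sup>+x. \<integral>\<^sup>+y. indicator (PiE I A) (?z (x, y)) \<partial>PiM I (\<lambda>_. N) \<partial>PiM I (\<lambda>_. M))"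
        by (rule PN.nn_integral_fst[symmetric]) measurable
      finally show ?thesis by simp
    qed
    also have "\<dots> = (\<integral>\<^sup>+x. \<integral>\<^sup>+y. (\<Prod>i\<in>I. indicator (A i) (x i, y i))
        \<partial>PiM I (\<lambda>_. N) \<partial>PiM I (\<lambda>_. M))"
      using I by (intro nn_integral_cong)
        (auto simp: indicator_def PiE_iff prod_zero_iff split: if_splits)
    also have "\<dots> = (\<Prod>i\<in>I. \<integral>\<^sup>+x. \<integral>\<^sup>+y. indicator (A i) (x, y) \<partial>N \<partial>M)"
      by (rule nn_integral_PiM_PiM_prod[OF I M N]) (use A in measurable)
    also have "\<dots> = (\<Prod>i\<in>I. emeasure (M \<Otimes>\<^sub>M N) (A i))"
      by (intro prod.cong refl N.emeasure_pair_measure[symmetric] A)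
    finally show "emeasure (distr (PiM I (\<lambda>_. M) \<Otimes>\<^sub>M PiM I (\<lambda>_. N)) (PiM I (\<lambda>_. M \<Otimes>\<^sub>M N))
        (\<lambda>(x, y). \<lambda>i\<in>I. (x i, y i))) (PiE I A) = (\<Prod>i\<in>I. emeasure (M \<Otimes>\<^sub>M N) (A i))" .
  qed simp
qed

text \<open>Provides the joint Ornstein-Uhlenbeck law with a density that is a product over
  hyperedges and can be multiplied out.\<close>

lemma PiM_density:
  fixes k :: "'a \<Rightarrow> ennreal"
  assumes I: "finite I" and M: "prob_space M"
    and k [measurable]: "k \<in> borel_measurable M" and D: "prob_space (density M k)"
  shows "PiM I (\<lambda>_. density M k) = density (PiM I (\<lambda>_. M)) (\<lambda>z. \<Prod>i\<in>I. k (z i))"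
proof -
  interpret D: product_prob_space "\<lambda>_. density M k" by (intro product_prob_spaceI D)
  interpret P: product_prob_space "\<lambda>_. M" by (intro product_prob_spaceI M)
  show ?thesis
  proof (rule D.PiM_eqI[OF I, symmetric])
    show "sets (density (PiM I (\<lambda>_. M)) (\<lambda>z. \<Prod>i\<in>I. k (z i))) = sets (PiM I (\<lambda>_. density M k))"
      by (simp cong: sets_PiM_cong)
    fix A assume "\<And>i. i \<in> I \<Longrightarrow> A i \<in> sets (density M k)"
    then have A [measurable]: "\<And>i. i \<in> I \<Longrightarrow> A i \<in> sets M" by simp
    have "emeasure (density (PiM I (\<lambda>_. M)) (\<lambda>z. \<Prod>i\<in>I. k (z i))) (PiE I A)
        = (\<integral>\<^sup>+z. (\<Prod>i\<in>I. k (z i)) * indicator (PiE I A) z \<partial>PiM I (\<lambda>_. M))"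
      by (rule emeasure_density) (use A I in \<open>auto intro!: sets_PiM_I_finite\<close>)
    also have "\<dots> = (\<integral>\<^sup>+z. (\<Prod>i\<in>I. k (z i) * indicator (A i) (z i)) \<partial>PiM I (\<lambda>_. M))"
      unfolding prod.distrib
      using I by (intro nn_integral_cong arg_cong2[where f="(*)"] refl)
        (auto simp: indicator_def PiE_iff space_PiM prod_zero_iff split: if_splits)
    also have "\<dots> = (\<Prod>i\<in>I. \<integral>\<^sup>+z. k z * indicator (A i) z \<partial>M)"
      by (rule P.product_nn_integral_prod[OF I]) (use A in measurable)
    also have "\<dots> = (\<Prod>i\<in>I. emeasure (density M k) (A i))"
      by (intro prod.cong refl emeasure_density[symmetric]) (use A in auto)
    finally show "emeasure (density (PiM I (\<lambda>_. M)) (\<lambda>z. \<Prod>i\<in>I. k (z i))) (PiE I A)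
      = (\<Prod>i\<in>I. emeasure (density M k) (A i))" .
  qed
qed

section \<open>Correlations of a product law and decay by sign flips\<close>

text \<open>\<open>L\<close> is the law of the pair at a single hyperedge. The restrictions appear
  because points of a product measure over \<open>E\<close> are functions that are undefined off
  \<open>E\<close>.\<close>

definition pair_corr :: "'e set \<Rightarrow> (real \<times> real) measure \<Rightarrow> (('e \<Rightarrow> real) \<Rightarrow> real) \<Rightarrow> real" where
  "pair_corr E L f =
    (\<integral>z. f (\<lambda>e\<in>E. fst (z e)) * f (\<lambda>e\<in>E. snd (z e)) \<partial>PiM E (\<lambda>_. L))"

text \<open>One law has several realisations: the semigroup identities compare two of them, and for
  resampling the keep flag is visible only on the larger space.\<close>

lemma pair_corr_distr:
  assumes E: "finite E" and \<Omega>: "prob_space \<Omega>"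
    and f [measurable]: "f \<in> borel_measurable (PiM E (\<lambda>_. borel))"
    and X [measurable]: "X \<in> borel_measurable \<Omega>" and Y [measurable]: "Y \<in> borel_measurable \<Omega>"
  shows "pair_corr E (distr \<Omega> (borel \<Otimes>\<^sub>M borel) (\<lambda>z. (X z, Y z))) f
    = (\<integral>z. f (\<lambda>e\<in>E. X (z e)) * f (\<lambda>e\<in>E. Y (z e)) \<partial>PiM E (\<lambda>_. \<Omega>))"
proof -
  have "pair_corr E (distr \<Omega> (borel \<Otimes>\<^sub>M borel) (\<lambda>z. (X z, Y z))) f
    = (\<integral>z. f (\<lambda>e\<in>E. fst (z e)) * f (\<lambda>e\<in>E. snd (z e))
        \<partial>distr (PiM E (\<lambda>_. \<Omega>)) (PiM E (\<lambda>_. borel \<Otimes>\<^sub>M borel)) (\<lambda>z. \<lambda>e\<in>E. (X (z e), Y (z e))))"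
    unfolding pair_corr_def
    by (subst distr_PiM_map[OF E \<Omega>, where h="\<lambda>_ z. (X z, Y z)", symmetric]) auto
  also have "\<dots> = (\<integral>z. f (\<lambda>e\<in>E. fst ((\<lambda>e\<in>E. (X (z e), Y (z e))) e))
      * f (\<lambda>e\<in>E. snd ((\<lambda>e\<in>E. (X (z e), Y (z e))) e)) \<partial>PiM E (\<lambda>_. \<Omega>))"
    by (rule integral_distr) measurable
  also have "\<dots> = (\<integral>z. f (\<lambda>e\<in>E. X (z e)) * f (\<lambda>e\<in>E. Y (z e)) \<partial>PiM E (\<lambda>_. \<Omega>))"
    by (intro Bochner_Integration.integral_cong refl arg_cong2[where f="(*)"] arg_cong[where f=f])
      (auto simp: restrict_def)
  finally show ?thesis .
qed

lemma pair_corr_le_1: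
  assumes L: "prob_space L" and f1: "\<And>x. \<bar>f x\<bar> \<le> 1"
  shows "pair_corr E L f \<le> 1"
proof -
  interpret P: prob_space "PiM E (\<lambda>_. L)" by (intro prob_space_PiM L)
  have ff: "f x * f y \<le> 1" for x y
    using mult_mono[OF f1[of x] f1[of y]] by (simp add: abs_mult[symmetric])
  \<comment> \<open>Nothing is assumed about measurability of \<open>f\<close>; if integrability
    fails, the integral is 0 by convention.\<close>
  show ?thesis
  proof (cases "integrable (PiM E (\<lambda>_. L)) (\<lambda>z. f (\<lambda>e\<in>E. fst (z e)) * f (\<lambda>e\<in>E. snd (z e)))")
    case True
    then have "pair_corr E L f \<le> (\<integral>z. 1 \<partial>PiM E (\<lambda>_. L))"
      unfolding pair_corr_def by (intro integral_mono ff) auto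
    then show ?thesis by (simp add: P.prob_space)
  qed (simp add: pair_corr_def not_integrable_integral_eq)
qed

section \<open>The squaring inequality and the removal of constants\<close>

lemma (in prob_space) square_expectation_le:
  fixes h :: "'a \<Rightarrow> real"
  assumes [measurable]: "h \<in> borel_measurable M" and h: "\<And>x. \<bar>h x\<bar> \<le> B"
  shows "(expectation h)\<^sup>2 \<le> expectation (\<lambda>x. (h x)\<^sup>2)"
proof -
  have 1: "integrable M h"
    by (rule integrable_const_bound[where B=B]) (auto simp: h)
  have 2: "integrable M (\<lambda>x. (h x)\<^sup>2)"
  proof (rule integrable_const_bound[where B="B\<^sup>2"])
    show "AE x in M. norm ((h x)\<^sup>2) \<le> B\<^sup>2"
      using power_mono[OF h, where n=2] by auto
  qed simp
  have "0 \<le> variance h" by (rule variance_positive)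
  with variance_eq[OF 1 2] show ?thesis by simp
qed

lemma integral_PiM_pair_zip:
  fixes g :: "('e \<Rightarrow> 'a \<times> 'b) \<Rightarrow> real"
  assumes E: "finite E" and M: "prob_space M" and N: "prob_space N"
    and g [measurable]: "g \<in> borel_measurable (PiM E (\<lambda>_. M \<Otimes>\<^sub>M N))"
  shows "(\<integral>z. g z \<partial>PiM E (\<lambda>_. M \<Otimes>\<^sub>M N))
    = (\<integral>p. g (\<lambda>e\<in>E. (fst p e, snd p e)) \<partial>(PiM E (\<lambda>_. M) \<Otimes>\<^sub>M PiM E (\<lambda>_. N)))"
  by (subst distr_PiM_pair_zip[OF E M N, symmetric], subst integral_distr)
    (auto simp: case_prod_unfold)

lemma integral_PiM_pair_zip_iterated:
  fixes g :: "('e \<Rightarrow> 'a \<times> 'b) \<Rightarrow> real"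
  assumes E: "finite E" and M: "prob_space M" and N: "prob_space N"
    and g [measurable]: "g \<in> borel_measurable (PiM E (\<lambda>_. M \<Otimes>\<^sub>M N))"
    and B: "\<And>z. \<bar>g z\<bar> \<le> B"
  shows "(\<integral>z. g z \<partial>PiM E (\<lambda>_. M \<Otimes>\<^sub>M N))
    = (\<integral>x. \<integral>y. g (\<lambda>e\<in>E. (x e, y e)) \<partial>PiM E (\<lambda>_. N) \<partial>PiM E (\<lambda>_. M))"
proof -
  interpret PM: prob_space "PiM E (\<lambda>_. M)" by (intro prob_space_PiM M)
  interpret PN: prob_space "PiM E (\<lambda>_. N)" by (intro prob_space_PiM N)
  interpret P: pair_prob_space "PiM E (\<lambda>_. M)" "PiM E (\<lambda>_. N)" ..
  have "integrable (PiM E (\<lambda>_. M) \<Otimes>\<^sub>M PiM E (\<lambda>_. N)) (\<lambda>(x, y). g (\<lambda>e\<in>E. (x e, y e)))"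
    by (rule P.integrable_const_bound[where B=B]) (auto simp: B)
  from P.integral_fst'[OF this] integral_PiM_pair_zip[OF E M N g] show ?thesis
    by (simp add: case_prod_unfold)
qed

text \<open>Let \<open>g x\<close> be the conditional expectation of \<open>f\<close> at the output,
  given the input \<open>x\<close>. The left correlation is the mean of \<open>f * g\<close>. On the
  right two outputs are drawn independently from one input, so that correlation is the mean of
  \<open>g\<close> squared. Cauchy-Schwarz and \<open>\<bar>f\<bar> \<le> 1\<close> conclude. For a
  reversible kernel the two outputs are distributed like a pair at twice the time.\<close>

lemma pair_corr_square_le:
  fixes f :: "('e \<Rightarrow> real) \<Rightarrow> real" and \<phi> :: "real \<Rightarrow> 'u \<Rightarrow> real"
  assumes E: "finite E" and M: "prob_space M" and N: "prob_space N"
    and sets_M [measurable_cong]: "sets M = sets borel"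
    and \<phi> [measurable]: "case_prod \<phi> \<in> borel_measurable (M \<Otimes>\<^sub>M N)"
    and f [measurable]: "f \<in> borel_measurable (PiM E (\<lambda>_. borel))"
    and f1: "\<And>x. \<bar>f x\<bar> \<le> 1"
  shows "(pair_corr E (distr (M \<Otimes>\<^sub>M N) (borel \<Otimes>\<^sub>M borel) (\<lambda>z. (fst z, \<phi> (fst z) (snd z)))) f)\<^sup>2
    \<le> pair_corr E (distr (M \<Otimes>\<^sub>M (N \<Otimes>\<^sub>M N)) (borel \<Otimes>\<^sub>M borel)
          (\<lambda>z. (\<phi> (fst z) (fst (snd z)), \<phi> (fst z) (snd (snd z))))) f"
proof -
  interpret M: prob_space M by fact
  interpret N: prob_space N by fact
  interpret MN: pair_prob_space M N ..
  interpret NN: pair_prob_space N N ..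
  interpret MNN: pair_prob_space M "N \<Otimes>\<^sub>M N" ..
  interpret PM: prob_space "PiM E (\<lambda>_. M)" by (intro prob_space_PiM M)
  interpret PN: prob_space "PiM E (\<lambda>_. N)" by (intro prob_space_PiM N)
  define g where "g x = (\<integral>u. f (\<lambda>e\<in>E. \<phi> (x e) (u e)) \<partial>PiM E (\<lambda>_. N))" for x
  have ff1: "\<bar>f x * f y\<bar> \<le> 1" for x y
    using mult_mono[OF f1[of x] f1[of y]] by (simp add: abs_mult)
  have [measurable]: "g \<in> borel_measurable (PiM E (\<lambda>_. M))"
    unfolding g_def by measurable
  have g1: "\<bar>g x\<bar> \<le> 1" for x
  proof (cases "integrable (PiM E (\<lambda>_. N)) (\<lambda>u. f (\<lambda>e\<in>E. \<phi> (x e) (u e)))")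
    case True
    then have "\<bar>g x\<bar> \<le> (\<integral>u. 1 \<partial>PiM E (\<lambda>_. N))"
      unfolding g_def by (intro integral_abs_bound[THEN order_trans] integral_mono) (auto simp: f1)
    then show ?thesis by (simp add: PN.prob_space)
  qed (simp add: g_def not_integrable_integral_eq)
  have "pair_corr E (distr (M \<Otimes>\<^sub>M N) (borel \<Otimes>\<^sub>M borel) (\<lambda>z. (fst z, \<phi> (fst z) (snd z)))) f
      = (\<integral>z. f (\<lambda>e\<in>E. fst (z e)) * f (\<lambda>e\<in>E. \<phi> (fst (z e)) (snd (z e))) \<partial>PiM E (\<lambda>_. M \<Otimes>\<^sub>M N))"
    by (rule pair_corr_distr[OF E MN.prob_space_axioms f]) measurable
  also have "\<dots> = (\<integral>x. \<integral>u. f (\<lambda>e\<in>E. fst ((\<lambda>e\<in>E. (x e, u e)) e))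
      * f (\<lambda>e\<in>E. \<phi> (fst ((\<lambda>e\<in>E. (x e, u e)) e)) (snd ((\<lambda>e\<in>E. (x e, u e)) e)))
        \<partial>PiM E (\<lambda>_. N) \<partial>PiM E (\<lambda>_. M))"
    by (rule integral_PiM_pair_zip_iterated[OF E M N, where B=1]) (measurable, rule ff1)
  also have "\<dots> = (\<integral>x. f (restrict x E) * g x \<partial>PiM E (\<lambda>_. M))"
    by (simp add: g_def cong: restrict_cong)
  finally have L: "pair_corr E (distr (M \<Otimes>\<^sub>M N) (borel \<Otimes>\<^sub>M borel)
      (\<lambda>z. (fst z, \<phi> (fst z) (snd z)))) f = \<dots>" .
  have "pair_corr E (distr (M \<Otimes>\<^sub>M (N \<Otimes>\<^sub>M N)) (borel \<Otimes>\<^sub>M borel)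
          (\<lambda>z. (\<phi> (fst z) (fst (snd z)), \<phi> (fst z) (snd (snd z))))) f
      = (\<integral>z. f (\<lambda>e\<in>E. \<phi> (fst (z e)) (fst (snd (z e)))) * f (\<lambda>e\<in>E. \<phi> (fst (z e)) (snd (snd (z e))))
          \<partial>PiM E (\<lambda>_. M \<Otimes>\<^sub>M (N \<Otimes>\<^sub>M N)))"
    by (rule pair_corr_distr[OF E MNN.prob_space_axioms f]) measurable
  also have "\<dots> = (\<integral>x. \<integral>v. f (\<lambda>e\<in>E. \<phi> (fst ((\<lambda>e\<in>E. (x e, v e)) e)) (fst (snd ((\<lambda>e\<in>E. (x e, v e)) e))))
      * f (\<lambda>e\<in>E. \<phi> (fst ((\<lambda>e\<in>E. (x e, v e)) e)) (snd (snd ((\<lambda>e\<in>E. (x e, v e)) e))))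
        \<partial>PiM E (\<lambda>_. N \<Otimes>\<^sub>M N) \<partial>PiM E (\<lambda>_. M))"
    by (rule integral_PiM_pair_zip_iterated[OF E M NN.prob_space_axioms, where B=1])
      (measurable, rule ff1)
  also have "\<dots> = (\<integral>x. (g x)\<^sup>2 \<partial>PiM E (\<lambda>_. M))"
  proof (rule Bochner_Integration.integral_cong[OF refl])
    fix x assume x [measurable]: "x \<in> space (PiM E (\<lambda>_. M))"
    have [measurable]: "x e \<in> space M" if "e \<in> E" for e
      using x that by (auto simp: space_PiM)
    have m [measurable]: "\<phi> (x e) \<in> borel_measurable N" if "e \<in> E" for e
      using measurable_compose[OF measurable_Pair1' \<phi>, of "x e"] that by simp
    have [measurable]: "(\<lambda>u. f (\<lambda>e\<in>E. \<phi> (x e) (u e))) \<in> borel_measurable (PiM E (\<lambda>_. N))"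
      by measurable
    have "(\<integral>v. f (\<lambda>e\<in>E. \<phi> (x e) (fst (v e))) * f (\<lambda>e\<in>E. \<phi> (x e) (snd (v e))) \<partial>PiM E (\<lambda>_. N \<Otimes>\<^sub>M N))
      = (\<integral>u. \<integral>w. f (\<lambda>e\<in>E. \<phi> (x e) (fst ((\<lambda>e\<in>E. (u e, w e)) e)))
          * f (\<lambda>e\<in>E. \<phi> (x e) (snd ((\<lambda>e\<in>E. (u e, w e)) e))) \<partial>PiM E (\<lambda>_. N) \<partial>PiM E (\<lambda>_. N))"
      by (rule integral_PiM_pair_zip_iterated[OF E N N, where B=1]) (measurable, rule ff1)
    also have "\<dots> = g x * g x"
      by (simp add: g_def cong: restrict_cong)
    finally show "(\<integral>v. f (\<lambda>e\<in>E. \<phi> (fst ((\<lambda>e\<in>E. (x e, v e)) e)) (fst (snd ((\<lambda>e\<in>E. (x e, v e)) e))))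
      * f (\<lambda>e\<in>E. \<phi> (fst ((\<lambda>e\<in>E. (x e, v e)) e)) (snd (snd ((\<lambda>e\<in>E. (x e, v e)) e))))
        \<partial>PiM E (\<lambda>_. N \<Otimes>\<^sub>M N)) = (g x)\<^sup>2"
      by (simp add: power2_eq_square cong: restrict_cong)
  qed
  finally have R: "pair_corr E (distr (M \<Otimes>\<^sub>M (N \<Otimes>\<^sub>M N)) (borel \<Otimes>\<^sub>M borel)
          (\<lambda>z. (\<phi> (fst z) (fst (snd z)), \<phi> (fst z) (snd (snd z))))) f = \<dots>" .
  have fg1: "\<bar>f (restrict x E) * g x\<bar> \<le> 1" for x
    using mult_mono[OF f1[of "restrict x E"] g1[of x]] by (simp add: abs_mult)
  have sq1: "(f x)\<^sup>2 \<le> 1" "(g x)\<^sup>2 \<le> 1" for x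
    using f1[of x] g1[of x] by (simp_all add: abs_square_le_1)
  have "(\<integral>x. f (restrict x E) * g x \<partial>PiM E (\<lambda>_. M))\<^sup>2
      \<le> (\<integral>x. (f (restrict x E) * g x)\<^sup>2 \<partial>PiM E (\<lambda>_. M))"
    by (rule PM.square_expectation_le[where B=1]) (measurable, rule fg1)
  also have "\<dots> \<le> (\<integral>x. (g x)\<^sup>2 \<partial>PiM E (\<lambda>_. M))"
  proof (rule integral_mono)
    show "integrable (PiM E (\<lambda>_. M)) (\<lambda>x. (f (restrict x E) * g x)\<^sup>2)"
      by (rule PM.integrable_const_bound[where B=1])
        (measurable, auto simp: power_mult_distrib intro!: mult_le_one sq1)
    show "integrable (PiM E (\<lambda>_. M)) (\<lambda>x. (g x)\<^sup>2)"
      by (rule PM.integrable_const_bound[where B=1]) (auto intro: sq1)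
    show "(f (restrict x E) * g x)\<^sup>2 \<le> (g x)\<^sup>2" for x
      using mult_right_mono[OF sq1(1)[of "restrict x E"], of "(g x)\<^sup>2"]
      by (simp add: power_mult_distrib)
  qed
  finally show ?thesis unfolding L R .
qed

text \<open>Repeated squaring removes the multiplicative constant from an exponential bound, as for
  any log-convex function.\<close>

lemma power_bound_by_squaring:
  fixes U :: "real \<Rightarrow> real"
  assumes sq: "\<And>a. 0 < a \<Longrightarrow> a < 1 \<Longrightarrow> (U a)\<^sup>2 \<le> U (a\<^sup>2)"
    and bd: "\<And>a. 0 < a \<Longrightarrow> a \<le> 1/2 \<Longrightarrow> U a \<le> C * a ^ d"
    and a: "0 < a" "a < 1"
  shows "U a \<le> a ^ d"
proof (rule ccontr)
  assume "\<not> U a \<le> a ^ d"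
  then have x: "1 < U a / a ^ d" using a by (simp add: field_simps)
  \<comment> \<open>Starting at exponent 2 keeps every power even and hence nonnegative, so it can
    be squared again without a sign condition on \<open>U\<close>.\<close>
  have it: "(U a) ^ (2 ^ Suc n) \<le> U (a ^ (2 ^ Suc n))" for n
  proof (induction n)
    case 0
    show ?case using sq[OF a] by (simp add: power2_eq_square)
  next
    case (Suc n)
    have "(U a) ^ (2 ^ Suc (Suc n)) = ((U a) ^ (2 ^ Suc n))\<^sup>2"
      by (simp flip: power_mult add: mult.commute)
    also have "\<dots> \<le> (U (a ^ (2 ^ Suc n)))\<^sup>2"
      by (rule power_mono[OF Suc]) (simp add: zero_le_even_power)
    also have "\<dots> \<le> U ((a ^ (2 ^ Suc n))\<^sup>2)"
      using a by (intro sq) (auto simp: power_Suc_less_one power_less_one_iff)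
    also have "(a ^ (2 ^ Suc n))\<^sup>2 = a ^ (2 ^ Suc (Suc n))"
      by (simp flip: power_mult add: mult.commute)
    finally show ?case .
  qed
  \<comment> \<open>\<open>m\<close> brings \<open>a\<close> into the range of the crude bound,
    \<open>k\<close> makes the assumed excess ratio overtake \<open>C\<close>; a power of two beyond
    both gives the contradiction.\<close>
  obtain m where m: "a ^ m < 1/2" using real_arch_pow_inv[of "1/2" a] a by auto
  obtain k where k: "C < (U a / a ^ d) ^ k" using real_arch_pow[OF x] by auto
  define n where "n = (2::nat) ^ Suc (m + k)"
  have "m + k < 2 ^ (m + k)" by (rule less_exp)
  then have n: "m \<le> n" "k \<le> n" unfolding n_def power_Suc by linarith+
  have "a ^ n \<le> a ^ m" using a n by (intro power_decreasing) auto
  then have "a ^ n \<le> 1/2" using m by linarith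
  then have "U (a ^ n) \<le> C * (a ^ n) ^ d" using a by (intro bd) auto
  with it[of "m + k"] have "(U a) ^ n \<le> C * (a ^ n) ^ d" by (simp add: n_def)
  then have "(U a / a ^ d) ^ n \<le> C"
    using a by (simp add: power_divide field_simps flip: power_mult)
  moreover have "(U a / a ^ d) ^ k \<le> (U a / a ^ d) ^ n"
    using x n by (intro power_increasing) auto
  ultimately show False using k by simp
qed

text \<open>All that the analytic part knows about the spin model: \<open>\<epsilon>\<close> stands
  for a gauge transformation fixing the couplings in \<open>S\<close>, and \<open>d\<close> for the
  distance of the two sites.\<close>

definition odd_under_sign_flips :: "'e set \<Rightarrow> nat \<Rightarrow> (('e \<Rightarrow> real) \<Rightarrow> real) \<Rightarrow> bool" where
  "odd_under_sign_flips E d f \<longleftrightarrow>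
    (\<forall>S\<subseteq>E. card S < d \<longrightarrow>
      (\<exists>\<epsilon>. (\<forall>e. \<epsilon> e = 1 \<or> \<epsilon> e = -1) \<and> (\<forall>e\<in>S. \<epsilon> e = 1) \<and>
        (\<forall>x. f (\<lambda>e\<in>E. \<epsilon> e * x e) = - f (restrict x E))))"

text \<open>Multiplying out the product gives one term for each set \<open>S\<close> of hyperedges
  that carry \<open>k1\<close>. If \<open>card S < d\<close>, a measure-preserving flip of
  coordinates off \<open>S\<close> turns the term into its negative, so it vanishes. Otherwise its
  size is at most \<open>(C * a) ^ card S\<close>. The \<open>2 ^ card E\<close> terms give the
  constant. \<open>Y\<close> is required to be invariant only where \<open>k0\<close> is nonzero
  because a kept coupling in the resampling dynamics does change sign with \<open>X\<close>.\<close>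

lemma correlation_decay:
  fixes f :: "('e \<Rightarrow> real) \<Rightarrow> real" and k0 k1 :: "'a \<Rightarrow> real"
  assumes E: "finite E" and \<Omega>: "prob_space \<Omega>"
    and f [measurable]: "f \<in> borel_measurable (PiM E (\<lambda>_. borel))"
    and f1: "\<And>x. \<bar>f x\<bar> \<le> 1" and odd: "odd_under_sign_flips E d f"
    and X [measurable]: "X \<in> borel_measurable \<Omega>" and Y [measurable]: "Y \<in> borel_measurable \<Omega>"
    and k0 [measurable]: "k0 \<in> borel_measurable \<Omega>" and k1: "integrable \<Omega> k1"
    and \<tau> [measurable]: "\<tau> \<in> \<Omega> \<rightarrow>\<^sub>M \<Omega>" and \<tau>_inv: "distr \<Omega> \<Omega> \<tau> = \<Omega>"
    and X\<tau>: "\<And>z. X (\<tau> z) = - X z" and Y\<tau>: "\<And>z. k0 z \<noteq> 0 \<Longrightarrow> Y (\<tau> z) = Y z"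
    and k0\<tau>: "\<And>z. k0 (\<tau> z) = k0 z" and k01: "\<And>z. 0 \<le> k0 z" "\<And>z. k0 z \<le> 1"
    and k1a: "(\<integral>z. \<bar>k1 z\<bar> \<partial>\<Omega>) \<le> C * a" and C: "1 \<le> C" and a: "0 \<le> a" "a \<le> 1"
  shows "(\<integral>z. (\<Prod>e\<in>E. k1 (z e) + k0 (z e)) * (f (\<lambda>e\<in>E. X (z e)) * f (\<lambda>e\<in>E. Y (z e)))
      \<partial>PiM E (\<lambda>_. \<Omega>)) \<le> (2 * C) ^ card E * a ^ d"
proof -
  interpret \<Omega>: prob_space \<Omega> by fact
  interpret P: product_prob_space "\<lambda>_. \<Omega>" by (intro product_prob_spaceI \<Omega>)
  interpret PP: prob_space "PiM E (\<lambda>_. \<Omega>)" by (intro prob_space_PiM \<Omega>)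
  let ?P = "PiM E (\<lambda>_. \<Omega>)"
  let ?F = "\<lambda>z. f (\<lambda>e\<in>E. X (z e)) * f (\<lambda>e\<in>E. Y (z e))"
  have [measurable]: "k1 \<in> borel_measurable \<Omega>" using k1 by auto
  define w where "w S z = (\<Prod>e\<in>S. k1 (z e)) * (\<Prod>e\<in>E-S. k0 (z e))" for S z
  have w_meas [measurable]: "w S \<in> borel_measurable ?P" if "S \<subseteq> E" for S
    unfolding w_def by (rule borel_measurable_times; rule borel_measurable_prod)
      (use that in \<open>auto intro!: measurable_compose[OF measurable_component_singleton]\<close>)
  have F1: "\<bar>?F z\<bar> \<le> 1" for z
    using mult_mono[OF f1[of "\<lambda>e\<in>E. X (z e)"] f1[of "\<lambda>e\<in>E. Y (z e)"]] by (simp add: abs_mult)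
  have w_le: "\<bar>w S z\<bar> \<le> (\<Prod>e\<in>E. if e \<in> S then \<bar>k1 (z e)\<bar> else 1)" if "S \<subseteq> E" for S z
  proof -
    have "\<bar>w S z\<bar> = (\<Prod>e\<in>S. \<bar>k1 (z e)\<bar>) * (\<Prod>e\<in>E-S. k0 (z e))"
      by (simp add: w_def abs_mult abs_prod k01 prod_nonneg)
    also have "\<dots> \<le> (\<Prod>e\<in>S. \<bar>k1 (z e)\<bar>) * 1"
      by (intro mult_left_mono prod_le_1 prod_nonneg) (auto simp: k01)
    also have "\<dots> = (\<Prod>e\<in>E. if e \<in> S then \<bar>k1 (z e)\<bar> else 1)"
      using E that by (simp add: prod.If_cases Int_absorb1)
    finally show ?thesis .
  qed
  have k1_if: "integrable \<Omega> (\<lambda>y. if e \<in> S then \<bar>k1 y\<bar> else 1)" for e S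
    by (cases "e \<in> S") (use k1 in auto)
  have bound_int: "integrable ?P (\<lambda>z. \<Prod>e\<in>E. if e \<in> S then \<bar>k1 (z e)\<bar> else 1)" for S
    by (rule P.product_integrable_prod[OF E, where f="\<lambda>e y. if e \<in> S then \<bar>k1 y\<bar> else 1"])
      (rule k1_if)
  have wF_le: "\<bar>w S z * ?F z\<bar> \<le> (\<Prod>e\<in>E. if e \<in> S then \<bar>k1 (z e)\<bar> else 1)" if "S \<subseteq> E" for S z
    using mult_mono[OF w_le[OF that] F1, of z z] by (simp add: abs_mult prod_nonneg)
  have wF_int: "integrable ?P (\<lambda>z. w S z * ?F z)" if "S \<subseteq> E" for S
    by (rule Bochner_Integration.integrable_bound[OF bound_int[of S]])
      (use that w_meas[OF that] in \<open>auto intro!: AE_I2 order_trans[OF wF_le] intro: order_trans[OF _ abs_ge_self]\<close>)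
  have term_le: "(\<integral>z. w S z * ?F z \<partial>?P) \<le> C ^ card E * a ^ d" if S: "S \<subseteq> E" for S
  proof (cases "card S < d")
    case True
    with odd S obtain \<epsilon> where \<epsilon>: "\<And>e. \<epsilon> e = 1 \<or> \<epsilon> e = -1" "\<And>e. e \<in> S \<Longrightarrow> \<epsilon> e = 1"
        and f\<epsilon>: "\<And>x. f (\<lambda>e\<in>E. \<epsilon> e * x e) = - f (restrict x E)"
      unfolding odd_under_sign_flips_def by meson
    \<comment> \<open>\<open>\<tau>\<close> acts on exactly the coordinates with sign -1, which
      multiplies each \<open>X\<close> by \<open>\<epsilon> e\<close> and preserves the product
      law.\<close>
    define h where "h e = (if \<epsilon> e = 1 then (\<lambda>z. z) else \<tau>)" for e
    have h [measurable]: "h e \<in> \<Omega> \<rightarrow>\<^sub>M \<Omega>" for e by (simp add: h_def)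
    have Xh: "X (h e z) = \<epsilon> e * X z" for e z using \<epsilon>(1)[of e] by (auto simp: h_def X\<tau>)
    have eq: "PiM E (\<lambda>_. \<Omega>) = distr ?P ?P (\<lambda>z. \<lambda>e\<in>E. h e (z e))"
      by (subst distr_PiM_map[OF E \<Omega> h]) (auto intro!: PiM_cong simp: h_def \<tau>_inv distr_id)
    have "(\<integral>z. w S z * ?F z \<partial>?P) = (\<integral>z. w S z * ?F z \<partial>distr ?P ?P (\<lambda>z. \<lambda>e\<in>E. h e (z e)))"
      using eq by simp
    also have "\<dots> = (\<integral>z. w S (\<lambda>e\<in>E. h e (z e)) * ?F (\<lambda>e\<in>E. h e (z e)) \<partial>?P)"
      by (rule integral_distr) (use S in measurable)
    also have "\<dots> = (\<integral>z. - (w S z * ?F z) \<partial>?P)"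
    proof (rule Bochner_Integration.integral_cong[OF refl])
      fix z
      have "w S (\<lambda>e\<in>E. h e (z e)) = w S z"
        unfolding w_def using S \<epsilon>(2)
        by (intro arg_cong2[where f="(*)"] prod.cong) (auto simp: h_def k0\<tau>)
      moreover have "f (\<lambda>e\<in>E. X ((\<lambda>e\<in>E. h e (z e)) e)) = - f (\<lambda>e\<in>E. X (z e))"
        using f\<epsilon>[of "\<lambda>e. X (z e)"] by (simp add: Xh cong: restrict_cong)
      \<comment> \<open>A nonzero weight forces \<open>k0\<close> to be nonzero at every hyperedge
        off \<open>S\<close>, where \<open>Y\<close> ignores \<open>\<tau>\<close>; on
        \<open>S\<close> nothing moves.\<close>
      moreover have "f (\<lambda>e\<in>E. Y ((\<lambda>e\<in>E. h e (z e)) e)) = f (\<lambda>e\<in>E. Y (z e))" if "w S z \<noteq> 0"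
      proof -
        have "Y (h e (z e)) = Y (z e)" if "e \<in> E" for e
        proof (cases "e \<in> S")
          case False
          with that E have "k0 (z e) \<noteq> 0" using \<open>w S z \<noteq> 0\<close> by (auto simp: w_def)
          then show ?thesis by (simp add: h_def Y\<tau>)
        qed (simp add: h_def \<epsilon>)
        then show ?thesis by (simp cong: restrict_cong)
      qed
      ultimately show "w S (\<lambda>e\<in>E. h e (z e)) * ?F (\<lambda>e\<in>E. h e (z e)) = - (w S z * ?F z)"
        by (cases "w S z = 0") auto
    qed
    finally have "(\<integral>z. w S z * ?F z \<partial>?P) = 0" by simp
    then show ?thesis using C a by simp
  next
    case False
    have fin: "finite S" using S E by (rule finite_subset)
    have "(\<integral>z. w S z * ?F z \<partial>?P) \<le> (\<integral>z. (\<Prod>e\<in>E. if e \<in> S then \<bar>k1 (z e)\<bar> else 1) \<partial>?P)"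
      by (intro integral_mono wF_int[OF S] bound_int) (use wF_le[OF S] in \<open>meson abs_le_D1\<close>)
    also have "\<dots> = (\<Prod>e\<in>E. \<integral>y. (if e \<in> S then \<bar>k1 y\<bar> else 1) \<partial>\<Omega>)"
      by (rule P.product_integral_prod[OF E, where f="\<lambda>e y. if e \<in> S then \<bar>k1 y\<bar> else 1"])
        (rule k1_if)
    also have "\<dots> = (\<Prod>e\<in>E. if e \<in> S then \<integral>y. \<bar>k1 y\<bar> \<partial>\<Omega> else 1)"
      by (intro prod.cong) (auto simp: \<Omega>.prob_space)
    also have "\<dots> = (\<integral>y. \<bar>k1 y\<bar> \<partial>\<Omega>) ^ card S"
      using E S by (simp add: prod.If_cases Int_absorb1)
    also have "\<dots> \<le> (C * a) ^ card S" by (intro power_mono k1a) simp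
    also have "\<dots> = C ^ card S * a ^ card S" by (rule power_mult_distrib)
    also have "\<dots> \<le> C ^ card E * a ^ d"
      using C a False card_mono[OF E S]
      by (intro mult_mono power_increasing power_decreasing) auto
    finally show ?thesis .
  qed
  have "(\<integral>z. (\<Prod>e\<in>E. k1 (z e) + k0 (z e)) * ?F z \<partial>?P) = (\<integral>z. (\<Sum>S\<in>Pow E. w S z * ?F z) \<partial>?P)"
    by (simp add: prod_add[OF E] w_def sum_distrib_right)
  also have "\<dots> = (\<Sum>S\<in>Pow E. \<integral>z. w S z * ?F z \<partial>?P)"
    by (rule Bochner_Integration.integral_sum) (auto intro: wF_int)
  also have "\<dots> \<le> (\<Sum>S\<in>Pow E. C ^ card E * a ^ d)"
    by (rule sum_mono) (auto intro: term_le)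
  also have "\<dots> = (2 * C) ^ card E * a ^ d"
    using E by (simp add: card_Pow power_mult_distrib)
  finally show ?thesis .
qed

section \<open>The Ornstein--Uhlenbeck pair law\<close>

abbreviation gauss :: "real measure" where
  "gauss \<equiv> std_normal_distribution"

lemma prob_space_gauss: "prob_space gauss"
  by (rule prob_space_normal_density) simp

lemma nn_integral_gauss:
  assumes "f \<in> borel_measurable borel"
  shows "(\<integral>\<^sup>+x. f x \<partial>gauss) = (\<integral>\<^sup>+x. ennreal (std_normal_density x) * f x \<partial>lborel)"
  using assms by (intro nn_integral_density) auto

lemma distr_gauss_uminus: "distr gauss gauss uminus = gauss"
proof (rule measure_eqI)
  fix A assume "A \<in> sets (distr gauss gauss uminus)"
  then have [measurable]: "A \<in> sets borel" by simp
  have "emeasure (distr gauss gauss uminus) A = (\<integral>\<^sup>+x. indicator A x \<partial>distr gauss gauss uminus)"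
    by simp
  also have "\<dots> = (\<integral>\<^sup>+x. indicator A (- x) \<partial>gauss)"
    by (rule nn_integral_distr) auto
  also have "\<dots> = (\<integral>\<^sup>+x. ennreal (std_normal_density x) * indicator A (- x) \<partial>lborel)"
    by (rule nn_integral_gauss) measurable
  also have "\<dots> = (\<integral>\<^sup>+x. ennreal (std_normal_density x) * indicator A x \<partial>lborel)"
    by (subst nn_integral_real_affine[where c="-1" and t=0]) (auto simp: std_normal_density_def)
  also have "\<dots> = (\<integral>\<^sup>+x. indicator A x \<partial>gauss)"
    by (rule nn_integral_gauss[symmetric]) measurable
  finally show "emeasure (distr gauss gauss uminus) A = emeasure gauss A" by simp
qed simp

text \<open>The Mehler kernel: the density of a standard Gaussian pair with correlation
  \<open>a\<close> relative to the independent pair.\<close>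

definition mehler :: "real \<Rightarrow> real \<Rightarrow> real \<Rightarrow> real" where
  "mehler a x y = exp ((2 * a * x * y - a\<^sup>2 * x\<^sup>2 - a\<^sup>2 * y\<^sup>2) / (2 * (1 - a\<^sup>2))) / sqrt (1 - a\<^sup>2)"

lemma mehler_measurable [measurable]:
  assumes [measurable]: "f \<in> borel_measurable M" "g \<in> borel_measurable M"
  shows "(\<lambda>z. mehler a (f z) (g z)) \<in> borel_measurable M"
  unfolding mehler_def by measurable

lemma mehler_sym: "mehler a x y = mehler a y x"
  by (simp add: mehler_def algebra_simps)

lemma mehler_nonneg: "\<bar>a\<bar> < 1 \<Longrightarrow> 0 \<le> mehler a x y"
  by (simp add: mehler_def abs_square_le_1)

text \<open>Completing the square in \<open>y\<close>; the right side is the conditional density of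
  \<open>a * x + sqrt (1 - a\<^sup>2) * u\<close> for Gaussian \<open>u\<close>.\<close>

lemma std_normal_density_mehler:
  assumes a: "\<bar>a\<bar> < 1"
  shows "std_normal_density y * mehler a x y = normal_density (a * x) (sqrt (1 - a\<^sup>2)) y"
proof -
  have s: "0 < 1 - a\<^sup>2" using a by (simp add: abs_square_less_1)
  have "- y\<^sup>2 / 2 + (2 * a * x * y - a\<^sup>2 * x\<^sup>2 - a\<^sup>2 * y\<^sup>2) / (2 * (1 - a\<^sup>2))
      = - (y - a * x)\<^sup>2 / (2 * (1 - a\<^sup>2))"
    using s by (simp add: field_simps power2_eq_square)
  then show ?thesis
    using s by (simp add: std_normal_density_def normal_density_def mehler_def real_sqrt_mult
        flip: exp_add)
qed

text \<open>Exchanges the additive noise, in which reversibility is hidden, for a kernel that is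
  symmetric in its arguments.\<close>

lemma nn_integral_gauss_affine:
  assumes a: "\<bar>a\<bar> < 1" and [measurable]: "f \<in> borel_measurable borel"
  shows "(\<integral>\<^sup>+u. f (a * x + sqrt (1 - a\<^sup>2) * u) \<partial>gauss)
    = (\<integral>\<^sup>+z. ennreal (mehler a x z) * f z \<partial>gauss)"
proof -
  define s where "s = sqrt (1 - a\<^sup>2)"
  have s: "0 < s" using a by (simp add: s_def abs_square_less_1)
  have "(\<integral>\<^sup>+z. ennreal (mehler a x z) * f z \<partial>gauss)
      = (\<integral>\<^sup>+z. ennreal (std_normal_density z) * (ennreal (mehler a x z) * f z) \<partial>lborel)"
    by (rule nn_integral_gauss) measurable
  also have "\<dots> = (\<integral>\<^sup>+z. ennreal (normal_density (a * x) s z) * f z \<partial>lborel)"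
    using a by (intro nn_integral_cong)
      (simp add: s_def std_normal_density_mehler[symmetric] ennreal_mult' mult.assoc mehler_nonneg)
  also have "\<dots> = ennreal s * (\<integral>\<^sup>+u. ennreal (normal_density (a * x) s (a * x + s * u)) * f (a * x + s * u) \<partial>lborel)"
    using s by (subst nn_integral_real_affine[where c=s and t="a * x"]) auto
  also have "\<dots> = (\<integral>\<^sup>+u. ennreal (std_normal_density u) * f (a * x + s * u) \<partial>lborel)"
  proof (subst nn_integral_cmult[symmetric], measurable, rule nn_integral_cong)
    fix u
    have "s * normal_density (a * x) s (a * x + s * u) = std_normal_density u"
      using s by (simp add: normal_density_def real_sqrt_mult field_simps)
    then show "ennreal s * (ennreal (normal_density (a * x) s (a * x + s * u)) * f (a * x + s * u))
        = ennreal (std_normal_density u) * f (a * x + s * u)"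
      using s by (simp flip: mult.assoc ennreal_mult')
  qed
  also have "\<dots> = (\<integral>\<^sup>+u. f (a * x + s * u) \<partial>gauss)"
    by (rule nn_integral_gauss[symmetric]) measurable
  finally show ?thesis by (simp add: s_def)
qed

text \<open>For \<open>a = exp (- t)\<close> this is the law of one coupling together with its
  continuous perturbation.\<close>

definition ou_law :: "real \<Rightarrow> (real \<times> real) measure" where
  "ou_law a = distr (gauss \<Otimes>\<^sub>M gauss) (borel \<Otimes>\<^sub>M borel)
    (\<lambda>z. (fst z, a * fst z + sqrt (1 - a\<^sup>2) * snd z))"

lemma nn_integral_gauss_sum:
  assumes "0 < \<sigma>" "0 < \<tau>" and [measurable]: "f \<in> borel_measurable borel"
  shows "(\<integral>\<^sup>+u. \<integral>\<^sup>+v. f (\<sigma> * u + \<tau> * v) \<partial>gauss \<partial>gauss)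
    = (\<integral>\<^sup>+w. f (sqrt (\<sigma>\<^sup>2 + \<tau>\<^sup>2) * w) \<partial>gauss)"
proof -
  interpret G: prob_space gauss by (rule prob_space_gauss)
  have scale: "(\<integral>\<^sup>+u. g (c * u) \<partial>gauss) = (\<integral>\<^sup>+z. ennreal (normal_density 0 c z) * g z \<partial>lborel)"
    if c: "0 < c" and [measurable]: "g \<in> borel_measurable borel" for c g
  proof -
    have "(\<integral>\<^sup>+z. ennreal (normal_density 0 c z) * g z \<partial>lborel)
      = ennreal c * (\<integral>\<^sup>+u. ennreal (normal_density 0 c (c * u)) * g (c * u) \<partial>lborel)"
      using c by (subst nn_integral_real_affine[where c=c and t=0]) auto
    also have "\<dots> = (\<integral>\<^sup>+u. ennreal (std_normal_density u) * g (c * u) \<partial>lborel)"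
    proof (subst nn_integral_cmult[symmetric], measurable, rule nn_integral_cong)
      fix u
      have "c * normal_density 0 c (c * u) = std_normal_density u"
        using c by (simp add: normal_density_def real_sqrt_mult field_simps)
      then show "ennreal c * (ennreal (normal_density 0 c (c * u)) * g (c * u))
        = ennreal (std_normal_density u) * g (c * u)"
        using c by (simp flip: mult.assoc ennreal_mult')
    qed
    also have "\<dots> = (\<integral>\<^sup>+u. g (c * u) \<partial>gauss)"
      by (rule nn_integral_gauss[symmetric]) measurable
    finally show ?thesis by simp
  qed
  have "(\<integral>\<^sup>+u. \<integral>\<^sup>+v. f (\<sigma> * u + \<tau> * v) \<partial>gauss \<partial>gauss)
      = (\<integral>\<^sup>+y. ennreal (normal_density 0 \<sigma> y) * (\<integral>\<^sup>+v. f (y + \<tau> * v) \<partial>gauss) \<partial>lborel)"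
    by (rule scale) (use assms in measurable)
  also have "\<dots> = (\<integral>\<^sup>+y. ennreal (normal_density 0 \<sigma> y)
      * (\<integral>\<^sup>+z. ennreal (normal_density 0 \<tau> z) * f (y + z) \<partial>lborel) \<partial>lborel)"
    by (intro nn_integral_cong arg_cong2[where f="(*)"] refl scale assms) measurable
  also have "\<dots> = (\<integral>\<^sup>+y. ennreal (normal_density 0 \<sigma> y)
      * (\<integral>\<^sup>+z. ennreal (normal_density 0 \<tau> (z - y)) * f z \<partial>lborel) \<partial>lborel)"
  proof (rule nn_integral_cong, rule arg_cong2[where f="(*)"], rule refl)
    fix y
    show "(\<integral>\<^sup>+z. ennreal (normal_density 0 \<tau> z) * f (y + z) \<partial>lborel)
      = (\<integral>\<^sup>+z. ennreal (normal_density 0 \<tau> (z - y)) * f z \<partial>lborel)"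
      by (subst (2) nn_integral_real_affine[where c=1 and t=y]) auto
  qed
  also have "\<dots> = (\<integral>\<^sup>+y. \<integral>\<^sup>+z. ennreal (normal_density 0 \<tau> (z - y) * normal_density 0 \<sigma> y) * f z
      \<partial>lborel \<partial>lborel)"
    by (simp add: nn_integral_cmult[symmetric] ennreal_mult' mult_ac)
  also have "\<dots> = (\<integral>\<^sup>+z. \<integral>\<^sup>+y. ennreal (normal_density 0 \<tau> (z - y) * normal_density 0 \<sigma> y) * f z
      \<partial>lborel \<partial>lborel)"
    by (rule lborel_pair.Fubini') measurable
  also have "\<dots> = (\<integral>\<^sup>+z. (\<integral>\<^sup>+y. ennreal (normal_density 0 \<tau> (z - y) * normal_density 0 \<sigma> y) \<partial>lborel) * f z
      \<partial>lborel)"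
    by (intro nn_integral_cong nn_integral_multc) measurable
  also have "\<dots> = (\<integral>\<^sup>+z. ennreal (normal_density 0 (sqrt (\<sigma>\<^sup>2 + \<tau>\<^sup>2)) z) * f z \<partial>lborel)"
    by (subst conv_normal_density_zero_mean[OF assms(2,1), THEN fun_cong]) (simp add: add.commute)
  also have "\<dots> = (\<integral>\<^sup>+w. f (sqrt (\<sigma>\<^sup>2 + \<tau>\<^sup>2) * w) \<partial>gauss)"
    using assms by (intro scale[symmetric]) (auto intro: add_pos_pos)
  finally show ?thesis .
qed

lemma emeasure_distr_pair_gauss:
  assumes N: "prob_space N" and A [measurable]: "A \<in> sets (borel \<Otimes>\<^sub>M borel)"
    and g [measurable]: "case_prod g \<in> gauss \<Otimes>\<^sub>M N \<rightarrow>\<^sub>M borel \<Otimes>\<^sub>M borel"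
  shows "emeasure (distr (gauss \<Otimes>\<^sub>M N) (borel \<Otimes>\<^sub>M borel) (\<lambda>z. g (fst z) (snd z))) A
    = (\<integral>\<^sup>+x. \<integral>\<^sup>+u. indicator A (g x u) \<partial>N \<partial>gauss)"
proof -
  interpret N: prob_space N by fact
  have "emeasure (distr (gauss \<Otimes>\<^sub>M N) (borel \<Otimes>\<^sub>M borel) (\<lambda>z. g (fst z) (snd z))) A
    = (\<integral>\<^sup>+z. indicator A z \<partial>distr (gauss \<Otimes>\<^sub>M N) (borel \<Otimes>\<^sub>M borel) (\<lambda>z. g (fst z) (snd z)))"
    by simp
  also have "\<dots> = (\<integral>\<^sup>+z. indicator A (g (fst z) (snd z)) \<partial>(gauss \<Otimes>\<^sub>M N))"
    by (rule nn_integral_distr) measurable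
  also have "\<dots> = (\<integral>\<^sup>+x. \<integral>\<^sup>+u. indicator A (g (fst (x, u)) (snd (x, u))) \<partial>N \<partial>gauss)"
    by (rule N.nn_integral_fst[symmetric]) measurable
  finally show ?thesis by simp
qed

lemma ou_law_density:
  assumes a: "\<bar>a\<bar> < 1"
  shows "ou_law a = density (gauss \<Otimes>\<^sub>M gauss) (\<lambda>z. ennreal (mehler a (fst z) (snd z)))"
proof (rule measure_eqI)
  interpret G: prob_space gauss by (rule prob_space_gauss)
  show "sets (ou_law a) = sets (density (gauss \<Otimes>\<^sub>M gauss) (\<lambda>z. ennreal (mehler a (fst z) (snd z))))"
    by (simp add: ou_law_def cong: sets_pair_measure_cong)
  fix A assume "A \<in> sets (ou_law a)"
  then have A [measurable]: "A \<in> sets (borel \<Otimes>\<^sub>M borel)" by (simp add: ou_law_def)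
  have A' [measurable]: "A \<in> sets (gauss \<Otimes>\<^sub>M gauss)"
    using A by (simp cong: sets_pair_measure_cong)
  have "emeasure (ou_law a) A
      = (\<integral>\<^sup>+x. \<integral>\<^sup>+u. indicator A (x, a * x + sqrt (1 - a\<^sup>2) * u) \<partial>gauss \<partial>gauss)"
    unfolding ou_law_def
    by (rule emeasure_distr_pair_gauss[OF prob_space_gauss A, where
          g="\<lambda>x u. (x, a * x + sqrt (1 - a\<^sup>2) * u)"]) measurable
  also have "\<dots> = (\<integral>\<^sup>+x. \<integral>\<^sup>+z. ennreal (mehler a x z) * indicator A (x, z) \<partial>gauss \<partial>gauss)"
    by (intro nn_integral_cong nn_integral_gauss_affine[OF a]) measurable
  also have "\<dots> = (\<integral>\<^sup>+z. ennreal (mehler a (fst z) (snd z)) * indicator A z \<partial>(gauss \<Otimes>\<^sub>M gauss))"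
    using G.nn_integral_fst[of "\<lambda>z. ennreal (mehler a (fst z) (snd z)) * indicator A z" gauss] A'
    by simp
  also have "\<dots> = emeasure (density (gauss \<Otimes>\<^sub>M gauss) (\<lambda>z. ennreal (mehler a (fst z) (snd z)))) A"
    by (rule emeasure_density[symmetric]) measurable
  finally show "emeasure (ou_law a) A = \<dots>" .
qed

text \<open>Reversibility (symmetry of the kernel) followed by the semigroup property.\<close>

lemma ou_law_square:
  assumes a: "0 < a" "a < 1"
  shows "distr (gauss \<Otimes>\<^sub>M (gauss \<Otimes>\<^sub>M gauss)) (borel \<Otimes>\<^sub>M borel)
      (\<lambda>z. (a * fst z + sqrt (1 - a\<^sup>2) * fst (snd z), a * fst z + sqrt (1 - a\<^sup>2) * snd (snd z)))
    = ou_law (a\<^sup>2)" (is "?L = _")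
proof (rule measure_eqI)
  interpret G: prob_space gauss by (rule prob_space_gauss)
  interpret GG: pair_prob_space gauss gauss ..
  define s where "s = sqrt (1 - a\<^sup>2)"
  have a1: "\<bar>a\<bar> < 1" using a by simp
  have s: "0 < s" "s\<^sup>2 = 1 - a\<^sup>2" using a by (simp_all add: s_def power_less_one_iff power_le_one)
  show "sets ?L = sets (ou_law (a\<^sup>2))" by (simp add: ou_law_def)
  fix A assume "A \<in> sets ?L"
  then have A [measurable]: "A \<in> sets (borel \<Otimes>\<^sub>M borel)" by simp
  define I :: "real \<Rightarrow> real \<Rightarrow> ennreal" where "I x y = indicator A (x, y)" for x y
  have I [measurable]: "(\<lambda>p. I (f p) (g p)) \<in> borel_measurable M"
    if [measurable]: "f \<in> borel_measurable M" "g \<in> borel_measurable M" for f g M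
    unfolding I_def by measurable
  have "emeasure ?L A = (\<integral>\<^sup>+x. \<integral>\<^sup>+p. I (a * x + s * fst p) (a * x + s * snd p) \<partial>(gauss \<Otimes>\<^sub>M gauss) \<partial>gauss)"
    unfolding I_def s_def
    by (rule emeasure_distr_pair_gauss[OF GG.prob_space_axioms A, where
          g="\<lambda>x p. (a * x + sqrt (1 - a\<^sup>2) * fst p, a * x + sqrt (1 - a\<^sup>2) * snd p)"]) measurable
  also have "\<dots> = (\<integral>\<^sup>+x. \<integral>\<^sup>+u. \<integral>\<^sup>+v. I (a * x + s * u) (a * x + s * v) \<partial>gauss \<partial>gauss \<partial>gauss)"
    using G.nn_integral_fst[of "\<lambda>p. I (a * x + s * fst p) (a * x + s * snd p)" gauss for x]
    by simp
  also have "\<dots> = (\<integral>\<^sup>+x. \<integral>\<^sup>+z. ennreal (mehler a x z) * (\<integral>\<^sup>+v. I z (a * x + s * v) \<partial>gauss)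
      \<partial>gauss \<partial>gauss)"
    unfolding s_def by (intro nn_integral_cong nn_integral_gauss_affine[OF a1]) measurable
  also have "\<dots> = (\<integral>\<^sup>+z. \<integral>\<^sup>+x. ennreal (mehler a x z) * (\<integral>\<^sup>+v. I z (a * x + s * v) \<partial>gauss)
      \<partial>gauss \<partial>gauss)"
    by (rule GG.Fubini') measurable
  \<comment> \<open>By symmetry of the kernel \<open>x\<close> is now generated from
    \<open>z\<close>, which leaves a chain of two successive steps started at
    \<open>z\<close>.\<close>
  also have "\<dots> = (\<integral>\<^sup>+z. \<integral>\<^sup>+u. \<integral>\<^sup>+v. I z (a * (a * z + s * u) + s * v) \<partial>gauss \<partial>gauss \<partial>gauss)"
    unfolding s_def
    by (subst mehler_sym, intro nn_integral_cong nn_integral_gauss_affine[OF a1, symmetric]) measurable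
  also have "\<dots> = (\<integral>\<^sup>+z. \<integral>\<^sup>+u. \<integral>\<^sup>+v. I z (a\<^sup>2 * z + ((a * s) * u + s * v)) \<partial>gauss \<partial>gauss \<partial>gauss)"
    by (simp add: algebra_simps power2_eq_square)
  also have "\<dots> = (\<integral>\<^sup>+z. \<integral>\<^sup>+w. I z (a\<^sup>2 * z + sqrt ((a * s)\<^sup>2 + s\<^sup>2) * w) \<partial>gauss \<partial>gauss)"
    using a s by (intro nn_integral_cong nn_integral_gauss_sum[where f="\<lambda>y. I z (a\<^sup>2 * z + y)" for z]) auto
  also have "(a * s)\<^sup>2 + s\<^sup>2 = 1 - (a\<^sup>2)\<^sup>2"
    unfolding power_mult_distrib s by (simp add: algebra_simps power2_eq_square)
  also have "(\<integral>\<^sup>+z. \<integral>\<^sup>+w. I z (a\<^sup>2 * z + sqrt (1 - (a\<^sup>2)\<^sup>2) * w) \<partial>gauss \<partial>gauss) = emeasure (ou_law (a\<^sup>2)) A"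
    unfolding ou_law_def I_def
    by (rule emeasure_distr_pair_gauss[OF prob_space_gauss A, where
          g="\<lambda>x u. (x, a\<^sup>2 * x + sqrt (1 - (a\<^sup>2)\<^sup>2) * u)", symmetric]) measurable
  finally show "emeasure ?L A = emeasure (ou_law (a\<^sup>2)) A" .
qed

text \<open>In Hermite terms this is the sum of all \<open>a ^ (2 * n)\<close>. It is computed here
  as a Gaussian integral, with the squared kernel and both densities merged into one quadratic
  form.\<close>

lemma mehler_square_integral:
  assumes a: "0 < a" "a < 1"
  shows "(\<integral>\<^sup>+z. ennreal ((mehler a (fst z) (snd z))\<^sup>2) \<partial>(gauss \<Otimes>\<^sub>M gauss)) = ennreal (1 / (1 - a\<^sup>2))"
proof -
  interpret G: prob_space gauss by (rule prob_space_gauss)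
  define q where "q = 1 - a\<^sup>2"
  \<comment> \<open>The merged exponent is
    \<open>- (c * x\<^sup>2 - 2 * b * x * y + c * y\<^sup>2) / 2\<close>. Its determinant
    \<open>c * c - b * b\<close> equals 1, so completing the square leaves variances
    \<open>c\<close> and \<open>1 / c\<close>, whose normalising constants cancel; only the
    prefactor \<open>1 / q\<close> survives.\<close>
  define c where "c = (1 + a\<^sup>2) / q"
  define b where "b = 2 * a / q"
  have q: "0 < q" using a by (simp add: q_def power_less_one_iff)
  have c: "0 < c" using q by (auto simp: c_def intro!: divide_pos_pos add_pos_nonneg)
  have cb: "c * c - b * b = 1"
  proof -
    have "(1 + a\<^sup>2)\<^sup>2 - (2 * a)\<^sup>2 = q\<^sup>2" by (simp add: q_def power2_eq_square algebra_simps)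
    then have "(1 + a\<^sup>2)\<^sup>2 / q\<^sup>2 - (2 * a)\<^sup>2 / q\<^sup>2 = 1"
      using q by (simp add: divide_simps)
    then show ?thesis by (simp add: c_def b_def power2_eq_square)
  qed
  have key: "std_normal_density x * (std_normal_density y * (mehler a x y)\<^sup>2)
      = 1 / q * (normal_density 0 (sqrt c) x * normal_density (b * x / c) (1 / sqrt c) y)" for x y
  proof -
    have e1: "(2 * a * x * y - a\<^sup>2 * x\<^sup>2 - a\<^sup>2 * y\<^sup>2) / q - x\<^sup>2 / 2 - y\<^sup>2 / 2
      = - (c * x\<^sup>2 - 2 * b * x * y + c * y\<^sup>2) / 2"
      using q by (simp add: c_def b_def field_simps) (simp add: q_def algebra_simps)
    have e2: "c * x\<^sup>2 - 2 * b * x * y + c * y\<^sup>2 = x\<^sup>2 / c + c * (y - b * x / c)\<^sup>2"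
    proof -
      have "c * (c * x\<^sup>2 - 2 * b * x * y + c * y\<^sup>2) = (c * c - b * b) * x\<^sup>2 + (c * y - b * x)\<^sup>2"
        by (simp add: power2_eq_square algebra_simps)
      also have "\<dots> = x\<^sup>2 + (c * y - b * x)\<^sup>2" by (simp add: cb)
      also have "\<dots> = c * (x\<^sup>2 / c + c * (y - b * x / c)\<^sup>2)"
        using c by (simp add: field_simps power2_eq_square)
      finally show ?thesis using c by simp
    qed
    have m: "(mehler a x y)\<^sup>2 = exp ((2 * a * x * y - a\<^sup>2 * x\<^sup>2 - a\<^sup>2 * y\<^sup>2) / q) / q"
      unfolding mehler_def q_def[symmetric] power_divide exp_double[symmetric]
      using q by (simp add: diff_divide_distrib)
    have "std_normal_density x * (std_normal_density y * (mehler a x y)\<^sup>2)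
      = 1 / q * (1 / (2 * pi)) * exp ((2 * a * x * y - a\<^sup>2 * x\<^sup>2 - a\<^sup>2 * y\<^sup>2) / q - x\<^sup>2 / 2 - y\<^sup>2 / 2)"
    proof -
      have "exp ((2 * a * x * y - a\<^sup>2 * x\<^sup>2 - a\<^sup>2 * y\<^sup>2) / q - x\<^sup>2 / 2 - y\<^sup>2 / 2)
        = exp ((2 * a * x * y - a\<^sup>2 * x\<^sup>2 - a\<^sup>2 * y\<^sup>2) / q) * exp (- x\<^sup>2 / 2) * exp (- y\<^sup>2 / 2)"
        by (simp flip: exp_add)
      moreover have "1 / sqrt (2 * pi) * (1 / sqrt (2 * pi)) = 1 / (2 * pi)"
        by simp
      ultimately show ?thesis
        unfolding m std_normal_density_def by (simp add: mult_ac)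
    qed
    also have "\<dots> = 1 / q * (1 / (2 * pi)) * (exp (- (x\<^sup>2 / c) / 2) * exp (- (c * (y - b * x / c)\<^sup>2) / 2))"
      unfolding e1 e2 by (simp add: exp_add[symmetric] field_simps)
    also have "\<dots> = 1 / q * (normal_density 0 (sqrt c) x * normal_density (b * x / c) (1 / sqrt c) y)"
      using c by (simp add: normal_density_def power_divide real_sqrt_mult real_sqrt_divide field_simps)
    finally show ?thesis .
  qed
  have "(\<integral>\<^sup>+z. ennreal ((mehler a (fst z) (snd z))\<^sup>2) \<partial>(gauss \<Otimes>\<^sub>M gauss))
      = (\<integral>\<^sup>+x. \<integral>\<^sup>+y. ennreal ((mehler a x y)\<^sup>2) \<partial>gauss \<partial>gauss)"
    using G.nn_integral_fst[of "\<lambda>z. ennreal ((mehler a (fst z) (snd z))\<^sup>2)" gauss] by simp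
  also have "\<dots> = (\<integral>\<^sup>+x. ennreal (std_normal_density x) *
      (\<integral>\<^sup>+y. ennreal (std_normal_density y) * ennreal ((mehler a x y)\<^sup>2) \<partial>lborel) \<partial>lborel)"
    by (subst nn_integral_gauss, measurable, intro nn_integral_cong arg_cong2[where f="(*)"] refl
        nn_integral_gauss) measurable
  also have "\<dots> = (\<integral>\<^sup>+x. (\<integral>\<^sup>+y. ennreal (1 / q * normal_density 0 (sqrt c) x)
      * ennreal (normal_density (b * x / c) (1 / sqrt c) y) \<partial>lborel) \<partial>lborel)"
    using q c
    by (subst nn_integral_cmult[symmetric], measurable, intro nn_integral_cong)
      (simp add: ennreal_mult'[symmetric] key mult_ac)
  also have "\<dots> = (\<integral>\<^sup>+x. ennreal (1 / q) * ennreal (normal_density 0 (sqrt c) x) \<partial>lborel)"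
  proof (rule nn_integral_cong)
    fix x
    have "(\<integral>\<^sup>+y. ennreal (normal_density (b * x / c) (1 / sqrt c) y) \<partial>lborel) = 1"
      using prob_space.emeasure_space_1[OF prob_space_normal_density[of "1 / sqrt c" "b * x / c"]] c
      by (simp add: emeasure_density)
    then show "(\<integral>\<^sup>+y. ennreal (1 / q * normal_density 0 (sqrt c) x)
        * ennreal (normal_density (b * x / c) (1 / sqrt c) y) \<partial>lborel)
      = ennreal (1 / q) * ennreal (normal_density 0 (sqrt c) x)"
      using q c by (subst nn_integral_cmult) (measurable, simp flip: ennreal_mult')
  qed
  also have "\<dots> = ennreal (1 / q)"
  proof -
    have "(\<integral>\<^sup>+x. ennreal (normal_density 0 (sqrt c) x) \<partial>lborel) = 1"
      using prob_space.emeasure_space_1[OF prob_space_normal_density[of "sqrt c" 0]] c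
      by (simp add: emeasure_density)
    then show ?thesis by (simp add: nn_integral_cmult)
  qed
  finally show ?thesis by (simp add: q_def)
qed

lemma prob_space_ou_law: "prob_space (ou_law a)"
proof -
  interpret G: prob_space gauss by (rule prob_space_gauss)
  interpret GG: pair_prob_space gauss gauss ..
  show ?thesis unfolding ou_law_def by (rule GG.prob_space_distr) measurable
qed

text \<open>The first absolute moment is reached through the second: the kernel has mean 1 and
  variance \<open>a\<^sup>2 / (1 - a\<^sup>2)\<close>, and \<open>a \<le> 1/2\<close> keeps the
  denominator away from 0.\<close>

lemma mehler_minus_one:
  assumes a: "0 < a" "a \<le> 1/2"
  shows "integrable (gauss \<Otimes>\<^sub>M gauss) (\<lambda>z. mehler a (fst z) (snd z) - 1)"
    and "(\<integral>z. \<bar>mehler a (fst z) (snd z) - 1\<bar> \<partial>(gauss \<Otimes>\<^sub>M gauss)) \<le> 2 * a"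
proof -
  interpret G: prob_space gauss by (rule prob_space_gauss)
  interpret GG: pair_prob_space gauss gauss ..
  let ?G = "gauss \<Otimes>\<^sub>M gauss"
  let ?m = "\<lambda>z. mehler a (fst z) (snd z)"
  have m0: "0 \<le> ?m z" for z using a by (intro mehler_nonneg) simp
  have "emeasure (ou_law a) (space ?G) = (\<integral>\<^sup>+z. ennreal (?m z) * indicator (space ?G) z \<partial>?G)"
    using a by (subst ou_law_density, simp) (rule emeasure_density, measurable)
  also have "\<dots> = (\<integral>\<^sup>+z. ennreal (?m z) \<partial>?G)"
    by (intro nn_integral_cong) simp
  also have "space ?G = space (ou_law a)" by (simp add: ou_law_def space_pair_measure)
  finally have m1: "(\<integral>\<^sup>+z. ennreal (?m z) \<partial>?G) = ennreal 1"
    by (simp add: prob_space.emeasure_space_1[OF prob_space_ou_law])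
  have m: "integrable ?G ?m" "(\<integral>z. ?m z \<partial>?G) = 1"
    using nn_integral_eq_integrable[of ?m ?G 1] m0 m1 by auto
  have m2: "integrable ?G (\<lambda>z. (?m z)\<^sup>2)" "(\<integral>z. (?m z)\<^sup>2 \<partial>?G) = 1 / (1 - a\<^sup>2)"
    using nn_integral_eq_integrable[of "\<lambda>z. (?m z)\<^sup>2" ?G "1 / (1 - a\<^sup>2)"]
      mehler_square_integral[of a] a by (auto simp: power_le_one)
  show i: "integrable ?G (\<lambda>z. ?m z - 1)" using m by simp
  \<comment> \<open>The weight in this arithmetic-geometric inequality is \<open>a\<close>, the
    order of the standard deviation, so that both summands have order \<open>a\<close> after
    integration.\<close>
  have amgm: "\<bar>y - 1\<bar> \<le> a / 2 + (y\<^sup>2 - 2 * y + 1) / (2 * a)" for y :: real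
  proof -
    have "0 \<le> (\<bar>y - 1\<bar> - a)\<^sup>2" by simp
    then have "2 * a * \<bar>y - 1\<bar> \<le> a\<^sup>2 + (y\<^sup>2 - 2 * y + 1)"
      by (simp add: power2_diff) (simp add: power2_eq_square algebra_simps)
    then show ?thesis using a by (simp add: field_simps power2_eq_square)
  qed
  have "(\<integral>z. \<bar>?m z - 1\<bar> \<partial>?G) \<le> (\<integral>z. a / 2 + ((?m z)\<^sup>2 - 2 * ?m z + 1) / (2 * a) \<partial>?G)"
    by (intro integral_mono amgm) (use i m m2 in auto)
  also have "\<dots> = a / 2 + (1 / (1 - a\<^sup>2) - 1) / (2 * a)"
    using m m2 by (simp add: GG.prob_space)
  also have "\<dots> \<le> 2 * a"
  proof -
    have a2: "a\<^sup>2 \<le> 1/4" using power_mono[of a "1/2" 2] a by (simp add: power_divide)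
    then have "1 / (1 - a\<^sup>2) - 1 = a\<^sup>2 / (1 - a\<^sup>2)" by (simp add: field_simps)
    also have "\<dots> \<le> a\<^sup>2 / (3/4)" by (intro divide_left_mono) (use a2 in auto)
    finally have "(1 / (1 - a\<^sup>2) - 1) / (2 * a) \<le> (a\<^sup>2 / (3/4)) / (2 * a)"
      using a by (intro divide_right_mono) auto
    also have "\<dots> = 2 / 3 * a" using a by (simp add: power2_eq_square)
    finally show ?thesis using a by linarith
  qed
  finally show "(\<integral>z. \<bar>?m z - 1\<bar> \<partial>?G) \<le> 2 * a" .
qed

section \<open>The resampling pair law and the correlation bounds\<close>

lemma emeasure_gauss_UNIV: "emeasure gauss UNIV = 1"
  using prob_space.emeasure_space_1[OF prob_space_gauss] by simp

definition resampling_noise :: "real \<Rightarrow> (real \<times> bool) measure" where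
  "resampling_noise p = gauss \<Otimes>\<^sub>M measure_pmf (bernoulli_pmf p)"

definition resample :: "real \<Rightarrow> real \<times> bool \<Rightarrow> real" where
  "resample x u = of_bool (snd u) * x + (1 - of_bool (snd u)) * fst u"

definition resample_law :: "real \<Rightarrow> (real \<times> real) measure" where
  "resample_law p = distr (gauss \<Otimes>\<^sub>M resampling_noise p) (borel \<Otimes>\<^sub>M borel)
    (\<lambda>z. (fst z, resample (fst z) (snd z)))"

lemma prob_space_resampling_noise: "prob_space (resampling_noise p)"
proof -
  interpret G: prob_space gauss by (rule prob_space_gauss)
  interpret B: prob_space "measure_pmf (bernoulli_pmf p)" by (rule prob_space_measure_pmf)
  interpret GB: pair_prob_space gauss "measure_pmf (bernoulli_pmf p)" ..
  show ?thesis unfolding resampling_noise_def by (rule GB.prob_space_axioms)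
qed

lemma sets_resampling_noise [measurable_cong]:
  "sets (resampling_noise p) = sets (borel \<Otimes>\<^sub>M count_space UNIV)"
  unfolding resampling_noise_def by (intro sets_pair_measure_cong) auto

lemma resample_measurable [measurable]:
  assumes [measurable]: "f \<in> borel_measurable M" "g \<in> M \<rightarrow>\<^sub>M borel \<Otimes>\<^sub>M count_space UNIV"
  shows "(\<lambda>z. resample (f z) (g z)) \<in> borel_measurable M"
  unfolding resample_def by measurable

lemma prob_space_resample_law: "prob_space (resample_law p)"
proof -
  interpret G: prob_space gauss by (rule prob_space_gauss)
  interpret N: prob_space "resampling_noise p" by (rule prob_space_resampling_noise)
  interpret GN: pair_prob_space gauss "resampling_noise p" ..
  show ?thesis unfolding resample_law_def by (rule GN.prob_space_distr) measurable
qed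

lemma nn_integral_resample:
  assumes p: "0 \<le> p" "p \<le> 1" and [measurable]: "h \<in> borel_measurable borel"
  shows "(\<integral>\<^sup>+u. h (resample x u) \<partial>resampling_noise p)
    = ennreal p * h x + ennreal (1 - p) * (\<integral>\<^sup>+y. h y \<partial>gauss)"
proof -
  interpret G: prob_space gauss by (rule prob_space_gauss)
  interpret B: prob_space "measure_pmf (bernoulli_pmf p)" by (rule prob_space_measure_pmf)
  have "(\<integral>\<^sup>+u. h (resample x u) \<partial>resampling_noise p)
      = (\<integral>\<^sup>+y. \<integral>\<^sup>+b. h (resample x (y, b)) \<partial>measure_pmf (bernoulli_pmf p) \<partial>gauss)"
    unfolding resampling_noise_def by (rule measure_pmf.nn_integral_fst[symmetric]) measurable
  also have "\<dots> = (\<integral>\<^sup>+y. ennreal p * h x + ennreal (1 - p) * h y \<partial>gauss)"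
    using p by (simp add: resample_def mult.commute)
  also have "\<dots> = ennreal p * h x + ennreal (1 - p) * (\<integral>\<^sup>+y. h y \<partial>gauss)"
    by (subst nn_integral_add) (auto simp: nn_integral_cmult emeasure_gauss_UNIV)
  finally show ?thesis .
qed

text \<open>A mixture of the diagonal law and the product law. For \<open>p > 0\<close> the diagonal
  part is singular, so the square identity is checked on sets rather than through densities.\<close>

lemma emeasure_resample_law:
  assumes p: "0 \<le> p" "p \<le> 1" and A [measurable]: "A \<in> sets (borel \<Otimes>\<^sub>M borel)"
  shows "emeasure (resample_law p) A
    = ennreal p * (\<integral>\<^sup>+x. indicator A (x, x) \<partial>gauss)
      + ennreal (1 - p) * (\<integral>\<^sup>+x. \<integral>\<^sup>+y. indicator A (x, y) \<partial>gauss \<partial>gauss)"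
proof -
  interpret G: prob_space gauss by (rule prob_space_gauss)
  have "emeasure (resample_law p) A
      = (\<integral>\<^sup>+x. \<integral>\<^sup>+u. indicator A (x, resample x u) \<partial>resampling_noise p \<partial>gauss)"
    unfolding resample_law_def
    by (rule emeasure_distr_pair_gauss[OF prob_space_resampling_noise A, where
          g="\<lambda>x u. (x, resample x u)"]) measurable
  also have "\<dots> = (\<integral>\<^sup>+x. ennreal p * indicator A (x, x)
      + ennreal (1 - p) * (\<integral>\<^sup>+y. indicator A (x, y) \<partial>gauss) \<partial>gauss)"
    by (intro nn_integral_cong nn_integral_resample[OF p]) measurable
  also have "\<dots> = ennreal p * (\<integral>\<^sup>+x. indicator A (x, x) \<partial>gauss)
      + ennreal (1 - p) * (\<integral>\<^sup>+x. \<integral>\<^sup>+y. indicator A (x, y) \<partial>gauss \<partial>gauss)"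
    by (subst nn_integral_add) (measurable, subst (1 2) nn_integral_cmult, auto)
  finally show ?thesis .
qed

text \<open>Both outputs copy the common input with probability \<open>p * p\<close>; in every other
  case they are independent standard Gaussians.\<close>

lemma resample_law_square:
  assumes p: "0 \<le> p" "p \<le> 1"
  shows "distr (gauss \<Otimes>\<^sub>M (resampling_noise p \<Otimes>\<^sub>M resampling_noise p)) (borel \<Otimes>\<^sub>M borel)
      (\<lambda>z. (resample (fst z) (fst (snd z)), resample (fst z) (snd (snd z))))
    = resample_law (p\<^sup>2)" (is "?L = _")
proof (rule measure_eqI)
  interpret G: prob_space gauss by (rule prob_space_gauss)
  interpret GG: pair_prob_space gauss gauss ..
  interpret N: prob_space "resampling_noise p" by (rule prob_space_resampling_noise)
  interpret NN: pair_prob_space "resampling_noise p" "resampling_noise p" ..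
  show "sets ?L = sets (resample_law (p\<^sup>2))" by (simp add: resample_law_def)
  fix A assume "A \<in> sets ?L"
  then have A [measurable]: "A \<in> sets (borel \<Otimes>\<^sub>M borel)" by simp
  define I :: "real \<Rightarrow> real \<Rightarrow> ennreal" where "I x y = indicator A (x, y)" for x y
  have I [measurable]: "(\<lambda>p. I (f p) (g p)) \<in> borel_measurable M"
    if [measurable]: "f \<in> borel_measurable M" "g \<in> borel_measurable M" for f g M
    unfolding I_def by measurable
  define D where "D = (\<integral>\<^sup>+x. I x x \<partial>gauss)"
  define J where "J = (\<integral>\<^sup>+x. \<integral>\<^sup>+y. I x y \<partial>gauss \<partial>gauss)"
  \<comment> \<open>If only the second output keeps the input, the product law appears with its
    coordinates exchanged.\<close>
  have J': "(\<integral>\<^sup>+x. \<integral>\<^sup>+y. I y x \<partial>gauss \<partial>gauss) = J"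
    unfolding J_def by (rule GG.Fubini') measurable
  have "emeasure ?L A = (\<integral>\<^sup>+x. \<integral>\<^sup>+q. I (resample x (fst q)) (resample x (snd q))
      \<partial>(resampling_noise p \<Otimes>\<^sub>M resampling_noise p) \<partial>gauss)"
    unfolding I_def
    by (rule emeasure_distr_pair_gauss[OF NN.prob_space_axioms A, where
          g="\<lambda>x q. (resample x (fst q), resample x (snd q))"]) measurable
  also have "\<dots> = (\<integral>\<^sup>+x. \<integral>\<^sup>+u. \<integral>\<^sup>+v. I (resample x u) (resample x v)
      \<partial>resampling_noise p \<partial>resampling_noise p \<partial>gauss)"
    using N.nn_integral_fst[of "\<lambda>q. I (resample x (fst q)) (resample x (snd q))" "resampling_noise p" for x]
    by simp
  also have "\<dots> = (\<integral>\<^sup>+x. \<integral>\<^sup>+u. ennreal p * I (resample x u) x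
      + ennreal (1 - p) * (\<integral>\<^sup>+z. I (resample x u) z \<partial>gauss) \<partial>resampling_noise p \<partial>gauss)"
    by (intro nn_integral_cong nn_integral_resample[OF p]) measurable
  also have "\<dots> = (\<integral>\<^sup>+x. ennreal p * (ennreal p * I x x + ennreal (1 - p) * (\<integral>\<^sup>+z. I x z \<partial>gauss))
      + ennreal (1 - p) * (\<integral>\<^sup>+y. ennreal p * I y x + ennreal (1 - p) * (\<integral>\<^sup>+z. I y z \<partial>gauss) \<partial>gauss)
      \<partial>gauss)"
    by (intro nn_integral_cong nn_integral_resample[OF p]) measurable
  also have "\<dots> = (\<integral>\<^sup>+x. ennreal p * (ennreal p * I x x + ennreal (1 - p) * (\<integral>\<^sup>+z. I x z \<partial>gauss))
      + ennreal (1 - p) * (ennreal p * (\<integral>\<^sup>+y. I y x \<partial>gauss) + ennreal (1 - p) * J) \<partial>gauss)"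
    unfolding J_def
    by (intro nn_integral_cong arg_cong2[where f="(+)"] arg_cong2[where f="(*)"] refl,
        subst nn_integral_add) (measurable, subst (1 2) nn_integral_cmult, auto)
  also have "\<dots> = ennreal p * (ennreal p * D + ennreal (1 - p) * J)
      + ennreal (1 - p) * (ennreal p * J + ennreal (1 - p) * J)"
    unfolding J'[symmetric]
    by (simp add: nn_integral_add nn_integral_cmult emeasure_gauss_UNIV D_def J_def J'[unfolded J_def])
  also have "\<dots> = ennreal (p\<^sup>2) * D + ennreal (1 - p\<^sup>2) * J"
  proof -
    have "1 - p\<^sup>2 = p * (1 - p) + ((1 - p) * p + (1 - p) * (1 - p))"
      by (simp add: power2_eq_square algebra_simps)
    then have "ennreal (1 - p\<^sup>2) = ennreal p * ennreal (1 - p) + (ennreal (1 - p) * ennreal p + ennreal (1 - p) * ennreal (1 - p))"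
      using p by (simp only: ennreal_plus ennreal_mult'' mult_nonneg_nonneg add_nonneg_nonneg diff_ge_0_iff_ge)
    moreover have "ennreal (p\<^sup>2) = ennreal p * ennreal p"
      using p by (simp flip: ennreal_mult' add: power2_eq_square)
    ultimately show ?thesis by (simp add: distrib_left distrib_right mult.assoc add.assoc)
  qed
  also have "\<dots> = emeasure (resample_law (p\<^sup>2)) A"
    using p by (subst emeasure_resample_law) (auto simp: I_def D_def J_def power_le_one)
  finally show "emeasure ?L A = emeasure (resample_law (p\<^sup>2)) A" .
qed

section \<open>Exponential decay of correlations for both dynamics\<close>

lemma ou_corr_le_power:
  assumes E: "finite E" and f [measurable]: "f \<in> borel_measurable (PiM E (\<lambda>_. borel))"
    and f1: "\<And>x. \<bar>f x\<bar> \<le> 1" and odd: "odd_under_sign_flips E d f"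
    and a: "0 < a" "a < 1"
  shows "pair_corr E (ou_law a) f \<le> a ^ d"
proof (rule power_bound_by_squaring[OF _ _ a])
  fix a :: real assume a: "0 < a" "a < 1"
  show "(pair_corr E (ou_law a) f)\<^sup>2 \<le> pair_corr E (ou_law (a\<^sup>2)) f"
    unfolding ou_law_square[OF a, symmetric] unfolding ou_law_def
    by (rule pair_corr_square_le[OF E prob_space_gauss prob_space_gauss, where
          \<phi>="\<lambda>x u. a * x + sqrt (1 - a\<^sup>2) * u"]) (auto simp: f1)
next
  fix a :: real assume a: "0 < a" "a \<le> 1/2"
  interpret G: prob_space gauss by (rule prob_space_gauss)
  interpret GG: pair_prob_space gauss gauss ..
  let ?G = "gauss \<Otimes>\<^sub>M gauss"
  let ?m = "\<lambda>z. mehler a (fst z) (snd z)"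
  have a1: "\<bar>a\<bar> < 1" using a by simp
  have flip: "distr ?G ?G (\<lambda>z. (- fst z, snd z)) = ?G"
    using pair_measure_distr[of uminus gauss gauss "\<lambda>x. x" gauss gauss]
    by (simp add: distr_gauss_uminus distr_id case_prod_unfold G.sigma_finite_measure_axioms)
  have "PiM E (\<lambda>_. ou_law a) = density (PiM E (\<lambda>_. ?G)) (\<lambda>z. \<Prod>e\<in>E. ennreal (?m (z e)))"
    unfolding ou_law_density[OF a1]
    by (rule PiM_density[OF E GG.prob_space_axioms])
      (use prob_space_ou_law[of a] in \<open>auto simp: ou_law_density[OF a1]\<close>)
  also have "\<dots> = density (PiM E (\<lambda>_. ?G)) (\<lambda>z. ennreal (\<Prod>e\<in>E. ?m (z e)))"
    by (simp add: prod_ennreal mehler_nonneg a1)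
  finally have "pair_corr E (ou_law a) f
      = (\<integral>z. f (\<lambda>e\<in>E. fst (z e)) * f (\<lambda>e\<in>E. snd (z e))
          \<partial>density (PiM E (\<lambda>_. ?G)) (\<lambda>z. ennreal (\<Prod>e\<in>E. ?m (z e))))"
    unfolding pair_corr_def by simp
  \<comment> \<open>The summand 1 is the density of the independent pair and serves as
    \<open>k0\<close>; the remainder has mass at most \<open>2 * a\<close>, hence
    \<open>C = 2\<close>. The flip reverses the first coupling only.\<close>
  also have "\<dots> = (\<integral>z. (\<Prod>e\<in>E. (?m (z e) - 1) + 1) * (f (\<lambda>e\<in>E. fst (z e)) * f (\<lambda>e\<in>E. snd (z e)))
      \<partial>PiM E (\<lambda>_. ?G))"
    by (subst integral_density) (auto simp: prod_nonneg mehler_nonneg a1)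
  also have "\<dots> \<le> (2 * 2) ^ card E * a ^ d"
    by (rule correlation_decay[OF E GG.prob_space_axioms f f1 odd, where \<tau>="\<lambda>z. (- fst z, snd z)"])
      (use a mehler_minus_one[OF a] flip in auto)
  finally show "pair_corr E (ou_law a) f \<le> (2 * 2) ^ card E * a ^ d" .
qed

lemma resample_corr_le_power:
  assumes E: "finite E" and f [measurable]: "f \<in> borel_measurable (PiM E (\<lambda>_. borel))"
    and f1: "\<And>x. \<bar>f x\<bar> \<le> 1" and odd: "odd_under_sign_flips E d f"
    and p: "0 < p" "p < 1"
  shows "pair_corr E (resample_law p) f \<le> p ^ d"
proof (rule power_bound_by_squaring[OF _ _ p])
  fix p :: real assume p: "0 < p" "p < 1"
  show "(pair_corr E (resample_law p) f)\<^sup>2 \<le> pair_corr E (resample_law (p\<^sup>2)) f"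
    using p unfolding resample_law_square[OF less_imp_le less_imp_le, OF p, symmetric] unfolding resample_law_def
    by (intro pair_corr_square_le[OF E prob_space_gauss prob_space_resampling_noise])
      (auto simp: f1 case_prod_unfold)
next
  fix p :: real assume p: "0 < p" "p \<le> 1/2"
  interpret G: prob_space gauss by (rule prob_space_gauss)
  interpret N: prob_space "resampling_noise p" by (rule prob_space_resampling_noise)
  interpret GN: pair_prob_space gauss "resampling_noise p" ..
  interpret B: prob_space "measure_pmf (bernoulli_pmf p)" by (rule prob_space_measure_pmf)
  let ?\<Omega> = "gauss \<Otimes>\<^sub>M resampling_noise p"
  let ?k = "\<lambda>z :: real \<times> real \<times> bool. of_bool (snd (snd z)) :: real"
  have flip: "distr ?\<Omega> ?\<Omega> (\<lambda>z. (- fst z, snd z)) = ?\<Omega>"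
    using pair_measure_distr[of uminus gauss gauss "\<lambda>x. x" "resampling_noise p" "resampling_noise p"]
    by (simp add: distr_gauss_uminus distr_id case_prod_unfold N.sigma_finite_measure_axioms)
  have k: "integrable ?\<Omega> ?k"
    by (rule GN.integrable_const_bound[where B=1]) auto
  have "(\<integral>z. ?k z \<partial>?\<Omega>) = (\<integral>x. \<integral>u. ?k (x, u) \<partial>resampling_noise p \<partial>gauss)"
    by (rule GN.integral_fst'[OF k, symmetric])
  also have "\<dots> = (\<integral>u. of_bool (snd u) \<partial>resampling_noise p)"
    using G.prob_space by simp
  also have "\<dots> = p"
  proof -
    interpret GB: pair_prob_space gauss "measure_pmf (bernoulli_pmf p)" ..
    have "integrable (gauss \<Otimes>\<^sub>M measure_pmf (bernoulli_pmf p)) (\<lambda>u. of_bool (snd u) :: real)"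
      by (rule GB.integrable_const_bound[where B=1]) auto
    from GB.integral_fst'[OF this] show ?thesis
      using p G.prob_space by (simp add: resampling_noise_def)
  qed
  finally have k_int: "(\<integral>z. \<bar>?k z\<bar> \<partial>?\<Omega>) = p" by simp
  have "pair_corr E (resample_law p) f
      = (\<integral>z. f (\<lambda>e\<in>E. fst (z e)) * f (\<lambda>e\<in>E. resample (fst (z e)) (snd (z e))) \<partial>PiM E (\<lambda>_. ?\<Omega>))"
    unfolding resample_law_def by (rule pair_corr_distr[OF E GN.prob_space_axioms f]) measurable
  \<comment> \<open>The keep flag splits the constant 1. A resampled hyperedge
    (\<open>k0 = 1\<close>) shows the fresh value, which a flip of the old coupling cannot affect; a
    flag has mean \<open>p\<close>, hence \<open>C = 1\<close>.\<close>
  also have "\<dots> = (\<integral>z. (\<Prod>e\<in>E. ?k (z e) + (1 - ?k (z e)))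
      * (f (\<lambda>e\<in>E. fst (z e)) * f (\<lambda>e\<in>E. resample (fst (z e)) (snd (z e)))) \<partial>PiM E (\<lambda>_. ?\<Omega>))"
    by simp
  also have "\<dots> \<le> (2 * 1) ^ card E * p ^ d"
    by (rule correlation_decay[OF E GN.prob_space_axioms f f1 odd, where \<tau>="\<lambda>z. (- fst z, snd z)"])
      (use p k k_int flip in \<open>auto simp: resample_def\<close>)
  finally show "pair_corr E (resample_law p) f \<le> (2 * 1) ^ card E * p ^ d" .
qed

text \<open>The perturbed disorder inside \<open>disorder_expectation\<close> is defined on all
  hyperedges, not restricted to \<open>E\<close>; assumption \<open>res\<close> lets
  \<open>f\<close> ignore its values elsewhere.\<close>

lemma disorder_expectation_pair_corr:
  assumes E: "finite E" and f [measurable]: "f \<in> borel_measurable (PiM E (\<lambda>_. borel))"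
    and res: "\<And>x. f (restrict x E) = f x"
  shows "disorder_expectation Continuous E t (\<lambda>J Jt. f J * f Jt) = pair_corr E (ou_law (exp (- t))) f"
    and "disorder_expectation Discrete E t (\<lambda>J Jt. f J * f Jt) = pair_corr E (resample_law (exp (- t))) f"
proof -
  interpret G: prob_space gauss by (rule prob_space_gauss)
  interpret GG: pair_prob_space gauss gauss ..
  let ?B = "measure_pmf (bernoulli_pmf (exp (- t)))"
  let ?N = "resampling_noise (exp (- t))"
  have B: "prob_space ?B" by (rule prob_space_measure_pmf)
  interpret N: prob_space ?N by (rule prob_space_resampling_noise)
  interpret GN: pair_prob_space gauss ?N ..
  interpret PG: prob_space "PiM E (\<lambda>_. gauss)" by (intro prob_space_PiM prob_space_gauss)
  interpret PB: prob_space "PiM E (\<lambda>_. ?B)" by (intro prob_space_PiM B)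
  interpret PGB: pair_prob_space "PiM E (\<lambda>_. gauss)" "PiM E (\<lambda>_. ?B)" ..
  have e2: "exp (- 2 * t) = (exp (- t))\<^sup>2"
    by (simp add: power2_eq_square flip: exp_add)
  have f_eq: "f x = f y" if "\<And>e. e \<in> E \<Longrightarrow> x e = y e" for x y
    using that by (metis res restrict_ext)
  have "pair_corr E (ou_law (exp (- t))) f
      = (\<integral>z. f (\<lambda>e\<in>E. fst (z e)) * f (\<lambda>e\<in>E. exp (- t) * fst (z e) + sqrt (1 - (exp (- t))\<^sup>2) * snd (z e))
          \<partial>PiM E (\<lambda>_. gauss \<Otimes>\<^sub>M gauss))"
    unfolding ou_law_def by (rule pair_corr_distr[OF E GG.prob_space_axioms f]) measurable
  also have "\<dots> = disorder_expectation Continuous E t (\<lambda>J Jt. f J * f Jt)"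
    unfolding disorder_expectation.simps gaussian_disorder_def e2
    by (subst integral_PiM_pair_zip[OF E prob_space_gauss prob_space_gauss], measurable,
        intro Bochner_Integration.integral_cong)
      (auto simp: case_prod_unfold intro!: arg_cong2[where f="(*)"] f_eq)
  finally show "disorder_expectation Continuous E t (\<lambda>J Jt. f J * f Jt)
    = pair_corr E (ou_law (exp (- t))) f" ..
  let ?z = "\<lambda>(x, y). \<lambda>i\<in>E. (x i, y i)"
  let ?h = "\<lambda>p. f (fst p) * f (\<lambda>e\<in>E. resample (fst p e) (snd p e))"
  have zip [measurable]: "?z \<in> PiM E (\<lambda>_. gauss) \<Otimes>\<^sub>M PiM E (\<lambda>_. ?B) \<rightarrow>\<^sub>M PiM E (\<lambda>_. ?N)"
    unfolding resampling_noise_def by measurable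
  have noise: "PiM E (\<lambda>_. ?N) = distr (PiM E (\<lambda>_. gauss) \<Otimes>\<^sub>M PiM E (\<lambda>_. ?B)) (PiM E (\<lambda>_. ?N)) ?z"
    unfolding resampling_noise_def by (rule distr_PiM_pair_zip[OF E prob_space_gauss B, symmetric])
  have h [measurable]: "?h \<in> borel_measurable (PiM E (\<lambda>_. gauss) \<Otimes>\<^sub>M PiM E (\<lambda>_. ?N))"
    by measurable
  have "pair_corr E (resample_law (exp (- t))) f
      = (\<integral>z. f (\<lambda>e\<in>E. fst (z e)) * f (\<lambda>e\<in>E. resample (fst (z e)) (snd (z e)))
          \<partial>PiM E (\<lambda>_. gauss \<Otimes>\<^sub>M ?N))"
    unfolding resample_law_def by (rule pair_corr_distr[OF E GN.prob_space_axioms f]) measurable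
  also have "\<dots> = (\<integral>p. ?h p \<partial>(PiM E (\<lambda>_. gauss) \<Otimes>\<^sub>M PiM E (\<lambda>_. ?N)))"
    by (subst integral_PiM_pair_zip[OF E prob_space_gauss N.prob_space_axioms], measurable,
        intro Bochner_Integration.integral_cong)
      (auto intro!: arg_cong2[where f="(*)"] f_eq)
  \<comment> \<open>The fresh couplings and the mask are separate factors of the expectation, while
    the noise pairs them by hyperedge; the regrouping acts on the second factor alone.\<close>
  also have "PiM E (\<lambda>_. gauss) \<Otimes>\<^sub>M PiM E (\<lambda>_. ?N)
      = distr (PiM E (\<lambda>_. gauss) \<Otimes>\<^sub>M (PiM E (\<lambda>_. gauss) \<Otimes>\<^sub>M PiM E (\<lambda>_. ?B)))
          (PiM E (\<lambda>_. gauss) \<Otimes>\<^sub>M PiM E (\<lambda>_. ?N)) (\<lambda>(x, q). (x, ?z q))"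
  proof -
    have "sigma_finite_measure (distr (PiM E (\<lambda>_. gauss) \<Otimes>\<^sub>M PiM E (\<lambda>_. ?B)) (PiM E (\<lambda>_. ?N)) ?z)"
      unfolding noise[symmetric]
      by (intro prob_space_imp_sigma_finite prob_space_PiM N.prob_space_axioms)
    from pair_measure_distr[OF measurable_ident_sets[OF refl] zip this, of "PiM E (\<lambda>_. gauss)"]
    show ?thesis unfolding noise[symmetric] distr_id .
  qed
  also have "(\<integral>p. ?h p \<partial>\<dots>) = (\<integral>p. ?h ((\<lambda>(x, q). (x, ?z q)) p)
      \<partial>(PiM E (\<lambda>_. gauss) \<Otimes>\<^sub>M (PiM E (\<lambda>_. gauss) \<Otimes>\<^sub>M PiM E (\<lambda>_. ?B))))"
    by (rule integral_distr) measurable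
  also have "\<dots> = disorder_expectation Discrete E t (\<lambda>J Jt. f J * f Jt)"
    unfolding disorder_expectation.simps gaussian_disorder_def bernoulli_mask_def
    by (intro Bochner_Integration.integral_cong refl)
      (auto simp: case_prod_unfold resample_def intro!: arg_cong2[where f="(*)"] f_eq)
  finally show "disorder_expectation Discrete E t (\<lambda>J Jt. f J * f Jt)
    = pair_corr E (resample_law (exp (- t))) f" ..
qed

section \<open>Gibbs measures, gauge symmetry and hypergraph distance\<close>

lemma disorder_expectation_sum:
  assumes E: "finite E" and I: "finite I"
    and f: "\<And>k. k \<in> I \<Longrightarrow> f k \<in> borel_measurable (PiM E (\<lambda>_. borel))"
    and f1: "\<And>k x. k \<in> I \<Longrightarrow> \<bar>f k x\<bar> \<le> 1"
    and res: "\<And>k x. k \<in> I \<Longrightarrow> f k (restrict x E) = f k x"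
  shows "disorder_expectation K E t (\<lambda>J Jt. (\<Sum>k\<in>I. f k J * f k Jt) / c)
    = (\<Sum>k\<in>I. disorder_expectation K E t (\<lambda>J Jt. f k J * f k Jt)) / c"
proof -
  let ?B = "measure_pmf (bernoulli_pmf (exp (- t)))"
  interpret PG: prob_space "PiM E (\<lambda>_. gauss)" by (intro prob_space_PiM prob_space_gauss)
  interpret PB: prob_space "PiM E (\<lambda>_. ?B)" by (intro prob_space_PiM prob_space_measure_pmf)
  interpret GG: pair_prob_space "PiM E (\<lambda>_. gauss)" "PiM E (\<lambda>_. gauss)" ..
  interpret GB: pair_prob_space "PiM E (\<lambda>_. gauss)" "PiM E (\<lambda>_. ?B)" ..
  interpret GGB: pair_prob_space "PiM E (\<lambda>_. gauss)" "PiM E (\<lambda>_. gauss) \<Otimes>\<^sub>M PiM E (\<lambda>_. ?B)" ..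
  have ff1: "\<bar>f k x * f k y\<bar> \<le> 1" if "k \<in> I" for k x y
    using mult_mono[OF f1[OF that, of x] f1[OF that, of y]] by (simp add: abs_mult)
  \<comment> \<open>Measurability of the perturbed disorder as a point of the product space holds
    only after restriction to \<open>E\<close>.\<close>
  have r: "f k (\<lambda>e. g e) = f k (\<lambda>e\<in>E. g e)" if "k \<in> I" for k g
    using res[OF that, of g] by simp
  show ?thesis
  proof (cases K)
    case Continuous
    have "integrable (PiM E (\<lambda>_. gauss) \<Otimes>\<^sub>M PiM E (\<lambda>_. gauss))
      (\<lambda>p. f k (fst p) * f k (\<lambda>e. exp (- t) * fst p e + sqrt (1 - exp (- 2 * t)) * snd p e))"
      if k: "k \<in> I" for k
    proof -
      note [measurable] = f[OF k]
      show ?thesis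
        by (rule GG.integrable_const_bound[where B=1])
          (auto simp: ff1[OF k], subst (2) r[OF k], measurable)
    qed
    with Continuous show ?thesis
      by (simp add: gaussian_disorder_def case_prod_unfold Bochner_Integration.integral_sum)
  next
    case Discrete
    have "integrable (PiM E (\<lambda>_. gauss) \<Otimes>\<^sub>M (PiM E (\<lambda>_. gauss) \<Otimes>\<^sub>M PiM E (\<lambda>_. ?B)))
      (\<lambda>p. f k (fst p) * f k (\<lambda>e. of_bool (snd (snd p) e) * fst p e
          + (1 - of_bool (snd (snd p) e)) * fst (snd p) e))"
      if k: "k \<in> I" for k
    proof -
      note [measurable] = f[OF k]
      show ?thesis
        by (rule GGB.integrable_const_bound[where B=1])
          (auto simp: ff1[OF k], subst (2) r[OF k], measurable)
    qed
    with Discrete show ?thesis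
      by (simp add: gaussian_disorder_def bernoulli_mask_def case_prod_unfold
          Bochner_Integration.integral_sum)
  qed
qed

section \<open>Gibbs measures at finite and infinite inverse temperature\<close>

lemma finite_configs: "finite (configs N)"
  unfolding configs_def by (intro finite_PiE) auto

lemma configs_ne: "configs N \<noteq> {}"
  unfolding configs_def by (auto simp: PiE_eq_empty_iff)

text \<open>Ensures that the weight \<open>1 / card\<close> at infinite inverse temperature is a
  genuine normalisation and not the default value of a division by 0.\<close>

lemma ground_states_ne: "ground_states N H \<noteq> {}"
proof -
  have "Max (H ` configs N) \<in> H ` configs N"
    by (intro Max_in) (auto simp: finite_configs configs_ne)
  then obtain \<sigma> where "\<sigma> \<in> configs N" "H \<sigma> = Max (H ` configs N)" by auto
  then show ?thesis by (auto simp: ground_states_def finite_configs)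
qed

lemma finite_ground_states: "finite (ground_states N H)"
  unfolding ground_states_def by (simp add: finite_configs)

lemma gibbs_nonneg: "0 \<le> gibbs N \<beta> H \<sigma>"
  unfolding gibbs_def by (auto intro!: divide_nonneg_nonneg sum_nonneg)

lemma sum_gibbs: "(\<Sum>\<sigma>\<in>configs N. gibbs N \<beta> H \<sigma>) = 1"
proof (cases "\<beta> = \<infinity>")
  case True
  have "ground_states N H \<subseteq> configs N" by (auto simp: ground_states_def)
  then have "(\<Sum>\<sigma>\<in>configs N. gibbs N \<beta> H \<sigma>)
      = (\<Sum>\<sigma>\<in>ground_states N H. 1 / real (card (ground_states N H)))"
    using True finite_configs[of N] by (simp add: gibbs_def sum.If_cases Int_absorb1)
  then show ?thesis
    using finite_ground_states[of N H] ground_states_ne[of N H] by (simp add: card_eq_0_iff)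
next
  case False
  have "0 < (\<Sum>\<tau>\<in>configs N. exp (enn2real \<beta> * H \<tau>))"
    by (intro sum_pos) (auto simp: finite_configs configs_ne)
  with False show ?thesis by (simp add: gibbs_def flip: sum_divide_distrib)
qed

text \<open>Both formulas for the Gibbs weight see only the energies, so the weight is transported
  by any bijection that matches energies; such a bijection also maps ground states onto ground
  states.\<close>

lemma gibbs_transform:
  assumes T: "bij_betw T (configs N) (configs N)"
    and H: "\<And>\<sigma>. \<sigma> \<in> configs N \<Longrightarrow> H' (T \<sigma>) = H \<sigma>" and \<sigma>: "\<sigma> \<in> configs N"
  shows "gibbs N \<beta> H' (T \<sigma>) = gibbs N \<beta> H \<sigma>"
proof -
  have surj: "T ` configs N = configs N" using T by (simp add: bij_betw_def)
  have gs: "T \<sigma> \<in> ground_states N H' \<longleftrightarrow> \<sigma> \<in> ground_states N H" if "\<sigma> \<in> configs N" for \<sigma>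
  proof -
    have "(\<forall>\<tau>\<in>T ` configs N. H' \<tau> \<le> H' (T \<sigma>)) \<longleftrightarrow> (\<forall>\<tau>\<in>configs N. H \<tau> \<le> H \<sigma>)"
      by (simp add: H that)
    moreover have "T \<sigma> \<in> configs N" using that surj by auto
    ultimately show ?thesis using that unfolding surj by (simp add: ground_states_def)
  qed
  have "ground_states N H' = T ` ground_states N H"
  proof (intro set_eqI iffI)
    fix x assume x: "x \<in> ground_states N H'"
    then obtain \<tau> where "\<tau> \<in> configs N" "x = T \<tau>"
      using surj by (auto simp: ground_states_def)
    with x gs show "x \<in> T ` ground_states N H" by auto
  qed (use gs in \<open>auto simp: ground_states_def\<close>)
  moreover have "inj_on T (ground_states N H)"
    using T by (auto simp: bij_betw_def ground_states_def intro: inj_on_subset)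
  ultimately have card: "card (ground_states N H') = card (ground_states N H)"
    by (simp add: card_image)
  have "(\<Sum>\<tau>\<in>configs N. exp (enn2real \<beta> * H' \<tau>)) = (\<Sum>\<tau>\<in>configs N. exp (enn2real \<beta> * H \<tau>))"
    using sum.reindex_bij_betw[OF T, of "\<lambda>\<tau>. exp (enn2real \<beta> * H' \<tau>)"] by (simp add: H)
  with card show ?thesis using gs[OF \<sigma>] H[OF \<sigma>] by (simp add: gibbs_def)
qed

definition two_point :: "nat \<Rightarrow> ennreal \<Rightarrow> (spins \<Rightarrow> real) \<Rightarrow> nat \<Rightarrow> nat \<Rightarrow> real" where
  "two_point N \<beta> H i j = (\<Sum>\<sigma>\<in>configs N. gibbs N \<beta> H \<sigma> * (\<sigma> i * \<sigma> j))"

lemma abs_two_point_le: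
  assumes "i \<in> {1..N}" "j \<in> {1..N}"
  shows "\<bar>two_point N \<beta> H i j\<bar> \<le> 1"
proof -
  have "\<bar>\<sigma> i * \<sigma> j\<bar> = 1" if "\<sigma> \<in> configs N" for \<sigma>
  proof -
    have "\<sigma> i \<in> {-1, 1}" "\<sigma> j \<in> {-1, 1}" using that assms unfolding configs_def by blast+
    then show ?thesis by auto
  qed
  then have "\<bar>two_point N \<beta> H i j\<bar> \<le> (\<Sum>\<sigma>\<in>configs N. gibbs N \<beta> H \<sigma>)"
    unfolding two_point_def
    by (intro sum_abs[THEN order_trans] sum_mono) (simp add: abs_mult gibbs_nonneg)
  then show ?thesis by (simp add: sum_gibbs)
qed

text \<open>For given disorder the two replicas are independent, so each term of the expanded square
  factorises.\<close>

lemma gibbs_avg2_overlap_sq: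
  "gibbs_avg2 N \<beta> H H' (\<lambda>\<sigma> \<tau>. (overlap N \<sigma> \<tau>)\<^sup>2)
    = (\<Sum>k\<in>{1..N} \<times> {1..N}. two_point N \<beta> H (fst k) (snd k) * two_point N \<beta> H' (fst k) (snd k))
      / (real N)\<^sup>2"
proof -
  have sq: "(overlap N \<sigma> \<tau>)\<^sup>2
      = (\<Sum>k\<in>{1..N} \<times> {1..N}. (\<sigma> (fst k) * \<sigma> (snd k)) * (\<tau> (fst k) * \<tau> (snd k))) / (real N)\<^sup>2" for \<sigma> \<tau>
    unfolding overlap_def power_divide
    by (simp add: power2_eq_square sum_product sum.cartesian_product case_prod_unfold mult_ac)
  have "gibbs_avg2 N \<beta> H H' (\<lambda>\<sigma> \<tau>. (overlap N \<sigma> \<tau>)\<^sup>2)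
      = (\<Sum>\<sigma>\<in>configs N. \<Sum>\<tau>\<in>configs N. \<Sum>k\<in>{1..N} \<times> {1..N}.
          (gibbs N \<beta> H \<sigma> * (\<sigma> (fst k) * \<sigma> (snd k))) * (gibbs N \<beta> H' \<tau> * (\<tau> (fst k) * \<tau> (snd k)))
            / (real N)\<^sup>2)"
    unfolding gibbs_avg2_def sq
    by (intro sum.cong refl) (simp add: sum_divide_distrib sum_distrib_left mult_ac)
  also have "\<dots> = (\<Sum>k\<in>{1..N} \<times> {1..N}. \<Sum>\<sigma>\<in>configs N. \<Sum>\<tau>\<in>configs N.
          (gibbs N \<beta> H \<sigma> * (\<sigma> (fst k) * \<sigma> (snd k))) * (gibbs N \<beta> H' \<tau> * (\<tau> (fst k) * \<tau> (snd k)))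
            / (real N)\<^sup>2)"
    by (subst sum.swap[of _ "{1..N} \<times> {1..N}"], subst (2) sum.swap) (rule refl)
  also have "\<dots> = (\<Sum>k\<in>{1..N} \<times> {1..N}.
      two_point N \<beta> H (fst k) (snd k) * two_point N \<beta> H' (fst k) (snd k)) / (real N)\<^sup>2"
    unfolding two_point_def sum_product by (simp add: sum_divide_distrib)
  finally show ?thesis .
qed

lemma hamiltonian_restrict: "hamiltonian \<Delta> E \<rho> (restrict J E) = hamiltonian \<Delta> E \<rho> J"
  unfolding hamiltonian_def by (intro ext sum.cong refl) (auto simp: layer_def)

lemma hamiltonian_measurable:
  assumes "\<And>p. p \<in> {2..\<Delta>} \<Longrightarrow> \<rho> p \<in> borel_measurable borel"
  shows "(\<lambda>J. hamiltonian \<Delta> E \<rho> J \<sigma>) \<in> borel_measurable (PiM E (\<lambda>_. borel))"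
  unfolding hamiltonian_def
proof (intro borel_measurable_sum borel_measurable_times borel_measurable_const)
  fix p e assume "p \<in> {2..\<Delta>}" and e: "e \<in> layer E p"
  have "(\<lambda>J. J e) \<in> borel_measurable (PiM E (\<lambda>_. borel))"
    by (rule measurable_component_singleton) (use e in \<open>simp add: layer_def\<close>)
  then show "(\<lambda>J. \<rho> p (J e)) \<in> borel_measurable (PiM E (\<lambda>_. borel))"
    by (rule measurable_compose) (use \<open>p \<in> {2..\<Delta>}\<close> assms in auto)
qed

text \<open>At infinite inverse temperature the Gibbs weights jump with the disorder, but they
  depend on it only through finitely many comparisons of energies.\<close>

lemma two_point_measurable:
  assumes H [measurable]: "\<And>\<sigma>. (\<lambda>J. H J \<sigma>) \<in> borel_measurable M"
  shows "(\<lambda>J. two_point N \<beta> (H J) i j) \<in> borel_measurable M"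
proof -
  note [simp] = finite_configs[of N]
  have gs [measurable]: "Measurable.pred M (\<lambda>J. \<sigma> \<in> ground_states N (H J))" for \<sigma>
    unfolding ground_states_def by measurable
  have "real (card (ground_states N (H J))) = (\<Sum>\<sigma>\<in>configs N. if \<sigma> \<in> ground_states N (H J) then 1 else 0)" for J
    by (simp add: sum.If_cases) (metis (no_types, lifting) Int_absorb1 ground_states_def mem_Collect_eq subsetI)
  then have [measurable]: "(\<lambda>J. real (card (ground_states N (H J)))) \<in> borel_measurable M"
    by simp
  show ?thesis
    unfolding two_point_def gibbs_def by (cases "\<beta> = \<infinity>") simp_all
qed

section \<open>Gauge transformations of spins and couplings\<close>

definition spin_flip :: "nat set \<Rightarrow> spins \<Rightarrow> spins" where
  "spin_flip A \<sigma> i = (if i \<in> A then - \<sigma> i else \<sigma> i)"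

lemma spin_flip_bij:
  assumes "A \<subseteq> {1..N}"
  shows "bij_betw (spin_flip A) (configs N) (configs N)"
proof (rule bij_betw_byWitness[where f'="spin_flip A"])
  show "spin_flip A ` configs N \<subseteq> configs N"
    using assms by (force simp: configs_def PiE_iff spin_flip_def extensional_def)
  then show "spin_flip A ` configs N \<subseteq> configs N" .
qed (auto simp: spin_flip_def fun_eq_iff)

lemma prod_spin_flip:
  assumes "finite e"
  shows "(\<Prod>i\<in>e. spin_flip A \<sigma> i) = (-1) ^ card (e \<inter> A) * (\<Prod>i\<in>e. \<sigma> i)"
proof -
  have "(\<Prod>i\<in>e. spin_flip A \<sigma> i) = (\<Prod>i\<in>e. (if i \<in> A then -1 else 1) * \<sigma> i)"
    by (intro prod.cong) (auto simp: spin_flip_def)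
  also have "\<dots> = (\<Prod>i\<in>e. if i \<in> A then -1 else 1) * (\<Prod>i\<in>e. \<sigma> i)"
    by (rule prod.distrib)
  also have "(\<Prod>i\<in>e. if i \<in> A then -1 else 1) = ((-1) ^ card (e \<inter> A) :: real)"
    using assms by (simp add: prod.If_cases)
  finally show ?thesis .
qed

text \<open>Flipping the spins in \<open>A\<close> multiplies the spin product of \<open>e\<close>
  by \<open>(-1) ^ card (e \<inter> A)\<close>; oddness of \<open>\<rho> p\<close> extracts the same
  sign from the coupling, and the two cancel.\<close>

lemma hamiltonian_gauge:
  assumes fin: "\<And>e. e \<in> E \<Longrightarrow> finite e"
    and odd: "\<And>p x. p \<in> {2..\<Delta>} \<Longrightarrow> \<rho> p (- x) = - \<rho> p x"
  shows "hamiltonian \<Delta> E \<rho> (\<lambda>e\<in>E. (-1) ^ card (e \<inter> A) * J e) (spin_flip A \<sigma>)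
    = hamiltonian \<Delta> E \<rho> J \<sigma>"
  unfolding hamiltonian_def
proof (intro sum.cong refl)
  fix p e assume p: "p \<in> {2..\<Delta>}" and e: "e \<in> layer E p"
  then have "e \<in> E" "finite e" using fin by (auto simp: layer_def)
  then show "\<rho> p ((\<lambda>e\<in>E. (-1) ^ card (e \<inter> A) * J e) e) * (\<Prod>i\<in>e. spin_flip A \<sigma> i)
      = \<rho> p (J e) * (\<Prod>i\<in>e. \<sigma> i)"
    by (cases "even (card (e \<inter> A))") (simp_all add: prod_spin_flip odd[OF p])
qed

text \<open>Unlike \<^const>\<open>berge_path\<close>, paths of length \<open>0\<close> are allowed here.\<close>

definition component :: "nat \<Rightarrow> hyperedge set \<Rightarrow> nat \<Rightarrow> nat set" where
  "component N S i = {v. \<exists>vs es. length vs = Suc (length es) \<and> set vs \<subseteq> {1..N} \<and> set es \<subseteq> S \<and>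
     distinct vs \<and> distinct es \<and> vs ! 0 = i \<and> vs ! length es = v \<and>
     (\<forall>k<length es. {vs ! k, vs ! Suc k} \<subseteq> es ! k)}"

lemma component_subset: "component N S i \<subseteq> {1..N}"
proof
  fix v assume "v \<in> component N S i"
  then obtain vs es where "length vs = Suc (length es)" "set vs \<subseteq> {1..N}" "set es \<subseteq> S"
      "vs ! length es = v"
    unfolding component_def by blast
  then show "v \<in> {1..N}" using nth_mem[of "length es" vs] by auto
qed

lemma component_refl: "i \<in> {1..N} \<Longrightarrow> i \<in> component N S i"
  unfolding component_def by (intro CollectI exI[of _ "[i]"] exI[of _ "[]"]) auto

text \<open>Appending \<open>e\<close> to a path might repeat a vertex or a hyperedge. The path is
  therefore cut at its first vertex in \<open>e\<close>: each hyperedge before the cut contains a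
  vertex outside \<open>e\<close> and so differs from \<open>e\<close>. If \<open>w\<close> already
  lies on the shortened path, it is its endpoint; otherwise \<open>e\<close> leads to it.\<close>

lemma component_closed:
  assumes v: "v \<in> component N S i" and e: "e \<in> S" "e \<subseteq> {1..N}" "v \<in> e" and w: "w \<in> e"
  shows "w \<in> component N S i"
proof -
  from v obtain vs es where P: "length vs = Suc (length es)" "set vs \<subseteq> {1..N}" "set es \<subseteq> S"
      "distinct vs" "distinct es" "vs ! 0 = i" "vs ! length es = v"
      and step: "\<And>k. k < length es \<Longrightarrow> {vs ! k, vs ! Suc k} \<subseteq> es ! k"
    unfolding component_def by blast
  define k where "k = (LEAST k. vs ! k \<in> e)"
  have k: "vs ! k \<in> e" "k \<le> length es"
    unfolding k_def by (rule LeastI[of _ "length es"], use P e in simp)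
      (rule Least_le, use P e in simp)
  have k_min: "vs ! m \<notin> e" if "m < k" for m
    using not_less_Least[OF that[unfolded k_def]] .
  have len: "length (take (Suc k) vs) = Suc (length (take k es))" using P k by simp
  show ?thesis
  proof (cases "w \<in> set (take (Suc k) vs)")
    case True
    then obtain m where "m \<le> k" "w = vs ! m" using P k by (auto simp: in_set_conv_nth less_Suc_eq_le)
    with w k_min have "w = vs ! k" by (metis le_neq_implies_less)
    then show ?thesis
      unfolding component_def
      using P k step set_take_subset[of "Suc k" vs] set_take_subset[of k es]
      by (intro CollectI exI[of _ "take (Suc k) vs"] exI[of _ "take k es"]) auto
  next
    case False
    have "e \<notin> set (take k es)"
    proof
      assume "e \<in> set (take k es)"
      then obtain m where "m < k" "es ! m = e" using k by (auto simp: in_set_conv_nth)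
      with step[of m] k k_min[of m] show False by auto
    qed
    moreover have "{(take (Suc k) vs @ [w]) ! m, (take (Suc k) vs @ [w]) ! Suc m} \<subseteq> (take k es @ [e]) ! m"
      if "m < Suc k" for m
      using that step[of m] k P w by (cases "m = k") (auto simp: nth_append)
    ultimately show ?thesis
      unfolding component_def
      using P k False w e set_take_subset[of "Suc k" vs] set_take_subset[of k es]
      by (intro CollectI exI[of _ "take (Suc k) vs @ [w]"] exI[of _ "take k es @ [e]"])
        (auto simp: nth_append)
  qed
qed

text \<open>A path that repeats no hyperedge of \<open>S\<close> has length at most
  \<open>card S\<close>; this is why components are built from paths with distinct hyperedges rather
  than from mere reachability.\<close>

lemma hdist_le_card:
  assumes "j \<in> component N S i" "S \<subseteq> E" "finite S"
  shows "hdist N E i j \<le> enat (card S)"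
proof (cases "i = j")
  case False
  from assms(1) obtain vs es where P: "length vs = Suc (length es)" "set vs \<subseteq> {1..N}" "set es \<subseteq> S"
      "distinct vs" "distinct es" "vs ! 0 = i" "vs ! length es = j"
      "\<forall>k<length es. {vs ! k, vs ! Suc k} \<subseteq> es ! k"
    unfolding component_def by blast
  then have "es \<noteq> []" using False by auto
  with P assms have "berge_path N E (length es) i j vs es"
    unfolding berge_path_def by (auto simp: Suc_le_eq)
  then have "hdist N E i j \<le> enat (length es)"
    using False unfolding hdist_def by (auto intro!: Inf_lower)
  also have "length es \<le> card S"
    using P assms by (metis card_mono distinct_card)
  finally show ?thesis by simp
qed (simp add: hdist_def)

context
  fixes N \<Delta> :: nat and E :: "hyperedge set" and \<rho> :: "nat \<Rightarrow> real \<Rightarrow> real"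
  assumes model: "mixed_even_model N \<Delta> E \<rho>"
begin

lemma hyperedge_props:
  assumes "e \<in> E"
  shows "e \<subseteq> {1..N}" "finite e" "even (card e)"
proof -
  show "e \<subseteq> {1..N}"
    using model assms by (auto simp: mixed_even_model_def hypergraph_def)
  then show "finite e" by (rule finite_subset) simp
  have "e \<in> layer E (card e)" using assms by (simp add: layer_def)
  then show "even (card e)" using model unfolding mixed_even_model_def by blast
qed

lemma finite_hyperedges: "finite E"
  by (rule finite_subset[of _ "Pow {1..N}"]) (use hyperedge_props(1) in auto)

lemma two_point_odd_under_sign_flips:
  assumes i: "i \<in> {1..N}" and j: "j \<in> {1..N}" and d: "enat d \<le> hdist N E i j"
  shows "odd_under_sign_flips E d (\<lambda>J. two_point N \<beta> (hamiltonian \<Delta> E \<rho> J) i j)"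
  unfolding odd_under_sign_flips_def
proof (intro allI impI)
  fix S assume S: "S \<subseteq> E" and card: "card S < d"
  define A where "A = component N S i"
  \<comment> \<open>A coupling changes sign exactly when its hyperedge meets \<open>A\<close> in an
    odd number of vertices.\<close>
  define \<epsilon> :: "hyperedge \<Rightarrow> real" where "\<epsilon> e = (-1) ^ card (e \<inter> A)" for e
  have iA: "i \<in> A" unfolding A_def by (rule component_refl[OF i])
  \<comment> \<open>Otherwise a path inside \<open>S\<close> would make the distance at most
    \<open>card S\<close>, which is less than \<open>d\<close>.\<close>
  have jA: "j \<notin> A"
    using hdist_le_card[of j N S i E] S card d finite_subset[OF S finite_hyperedges]
    unfolding A_def by (metis enat_ord_simps(2) leD order_trans not_le)
  have "\<epsilon> e = 1" if "e \<in> S" for e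
  proof -
    have e: "e \<subseteq> {1..N}" "even (card e)" using that S hyperedge_props by auto
    \<comment> \<open>A hyperedge of \<open>S\<close> lies inside \<open>A\<close> or misses it. If
      it lies inside, all its vertices are flipped, and evenness of the hyperedge makes the sign
      1.\<close>
    have "e \<inter> A = {} \<or> e \<inter> A = e"
      using component_closed[OF _ that e(1)] unfolding A_def by blast
    then show ?thesis using e by (auto simp: \<epsilon>_def)
  qed
  moreover have "\<epsilon> e = 1 \<or> \<epsilon> e = -1" for e
    unfolding \<epsilon>_def by (cases "even (card (e \<inter> A))") auto
  moreover have "two_point N \<beta> (hamiltonian \<Delta> E \<rho> (\<lambda>e\<in>E. \<epsilon> e * J e)) i j
      = - two_point N \<beta> (hamiltonian \<Delta> E \<rho> (restrict J E)) i j" for J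
  proof -
    let ?H' = "hamiltonian \<Delta> E \<rho> (\<lambda>e\<in>E. \<epsilon> e * J e)" and ?H = "hamiltonian \<Delta> E \<rho> J"
    have bij: "bij_betw (spin_flip A) (configs N) (configs N)"
      by (rule spin_flip_bij) (simp only: A_def component_subset)
    have H: "?H' (spin_flip A \<sigma>) = ?H \<sigma>" for \<sigma>
      unfolding \<epsilon>_def
      by (rule hamiltonian_gauge) (use model hyperedge_props in \<open>auto simp: mixed_even_model_def\<close>)
    have "two_point N \<beta> ?H' i j
        = (\<Sum>\<sigma>\<in>configs N. gibbs N \<beta> ?H' (spin_flip A \<sigma>) * (spin_flip A \<sigma> i * spin_flip A \<sigma> j))"
      unfolding two_point_def by (rule sum.reindex_bij_betw[OF bij, symmetric])
    also have "\<dots> = (\<Sum>\<sigma>\<in>configs N. - (gibbs N \<beta> ?H \<sigma> * (\<sigma> i * \<sigma> j)))"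
    proof (rule sum.cong[OF refl])
      fix \<sigma> assume "\<sigma> \<in> configs N"
      then have "gibbs N \<beta> ?H' (spin_flip A \<sigma>) = gibbs N \<beta> ?H \<sigma>"
        by (intro gibbs_transform[OF bij] H)
      then show "gibbs N \<beta> ?H' (spin_flip A \<sigma>) * (spin_flip A \<sigma> i * spin_flip A \<sigma> j)
          = - (gibbs N \<beta> ?H \<sigma> * (\<sigma> i * \<sigma> j))"
        using iA jA by (simp add: spin_flip_def)
    qed
    also have "\<dots> = - two_point N \<beta> ?H i j" by (simp add: two_point_def sum_negf)
    finally show ?thesis by (simp add: hamiltonian_restrict)
  qed
  ultimately show "\<exists>\<epsilon>. (\<forall>e. \<epsilon> e = 1 \<or> \<epsilon> e = - 1) \<and> (\<forall>e\<in>S. \<epsilon> e = 1) \<and>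
      (\<forall>x. two_point N \<beta> (hamiltonian \<Delta> E \<rho> (\<lambda>e\<in>E. \<epsilon> e * x e)) i j
        = - two_point N \<beta> (hamiltonian \<Delta> E \<rho> (restrict x E)) i j)"
    by blast
qed

end

section \<open>Decay of spin correlations and growth of balls\<close>

definition spin_corr ::
  "perturbation \<Rightarrow> nat \<Rightarrow> nat \<Rightarrow> hyperedge set \<Rightarrow> (nat \<Rightarrow> real \<Rightarrow> real) \<Rightarrow> ennreal \<Rightarrow> real
    \<Rightarrow> nat \<Rightarrow> nat \<Rightarrow> real"
where
  "spin_corr K N \<Delta> E \<rho> \<beta> t i j = disorder_expectation K E t (\<lambda>J Jt.
     two_point N \<beta> (hamiltonian \<Delta> E \<rho> J) i j * two_point N \<beta> (hamiltonian \<Delta> E \<rho> Jt) i j)"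

lemma two_point_hamiltonian_measurable:
  assumes "mixed_even_model N \<Delta> E \<rho>"
  shows "(\<lambda>J. two_point N \<beta> (hamiltonian \<Delta> E \<rho> J) i j) \<in> borel_measurable (PiM E (\<lambda>_. borel))"
  by (intro two_point_measurable hamiltonian_measurable)
    (use assms in \<open>auto simp: mixed_even_model_def\<close>)

text \<open>\<open>d\<close> is any natural number not above the distance: this covers infinite
  distance by letting \<open>d\<close> grow, and \<open>d = 0\<close> supplies the trivial bound
  1.\<close>

lemma spin_corr_le:
  assumes model: "mixed_even_model N \<Delta> E \<rho>" and t: "0 \<le> t"
    and i: "i \<in> {1..N}" and j: "j \<in> {1..N}" and d: "enat d \<le> hdist N E i j"
  shows "spin_corr K N \<Delta> E \<rho> \<beta> t i j \<le> exp (- t) ^ d"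
proof -
  define f where "f J = two_point N \<beta> (hamiltonian \<Delta> E \<rho> J) i j" for J
  have E: "finite E" by (rule finite_hyperedges[OF model])
  have f: "f \<in> borel_measurable (PiM E (\<lambda>_. borel))"
    unfolding f_def by (rule two_point_hamiltonian_measurable[OF model])
  have f1: "\<bar>f x\<bar> \<le> 1" for x unfolding f_def by (rule abs_two_point_le[OF i j])
  have res: "f (restrict x E) = f x" for x by (simp add: f_def hamiltonian_restrict)
  have odd: "odd_under_sign_flips E d f"
    unfolding f_def by (rule two_point_odd_under_sign_flips[OF model i j d])
  have corr: "spin_corr K N \<Delta> E \<rho> \<beta> t i j
      = pair_corr E (case K of Continuous \<Rightarrow> ou_law (exp (- t)) | Discrete \<Rightarrow> resample_law (exp (- t))) f"
    unfolding spin_corr_def f_def[symmetric]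
    by (cases K) (simp_all only: disorder_expectation_pair_corr[OF E f res] perturbation.case)
  show ?thesis
  proof (cases "t = 0")
    \<comment> \<open>At \<open>t = 0\<close> the parameter equals 1, where the Mehler kernel
      degenerates; the claim is then the bound 1.\<close>
    case True
    have "spin_corr K N \<Delta> E \<rho> \<beta> t i j \<le> 1"
      unfolding corr
      by (intro pair_corr_le_1 f1) (auto split: perturbation.split
          intro: prob_space_ou_law prob_space_resample_law)
    with True show ?thesis by simp
  next
    case False
    with t have "0 < exp (- t)" "exp (- t) < 1" by auto
    then show ?thesis
      unfolding corr
      by (cases K) (simp_all add: ou_corr_le_power[OF E f f1 odd] resample_corr_le_power[OF E f f1 odd])
  qed
qed

text \<open>One factor \<open>1 / N\<close> of the double sum is spent on averaging over
  \<open>i\<close>, so a uniform bound on rows suffices.\<close>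

lemma mean_sq_overlap_le_row:
  assumes model: "mixed_even_model N \<Delta> E \<rho>"
    and row: "\<And>i. i \<in> {1..N} \<Longrightarrow> (\<Sum>j\<in>{1..N}. spin_corr K N \<Delta> E \<rho> \<beta> t i j) \<le> R"
  shows "mean_sq_overlap K N \<Delta> E \<rho> \<beta> t \<le> R / real N"
proof -
  have N: "0 < N" using model by (simp add: mixed_even_model_def)
  have "mean_sq_overlap K N \<Delta> E \<rho> \<beta> t
      = (\<Sum>k\<in>{1..N} \<times> {1..N}. spin_corr K N \<Delta> E \<rho> \<beta> t (fst k) (snd k)) / (real N)\<^sup>2"
    unfolding mean_sq_overlap_def gibbs_avg2_overlap_sq spin_corr_def
    by (rule disorder_expectation_sum[OF finite_hyperedges[OF model]])
      (auto simp: hamiltonian_restrict intro!: abs_two_point_le two_point_hamiltonian_measurable[OF model])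
  also have "\<dots> = (\<Sum>i\<in>{1..N}. \<Sum>j\<in>{1..N}. spin_corr K N \<Delta> E \<rho> \<beta> t i j) / (real N)\<^sup>2"
    by (simp add: sum.cartesian_product case_prod_unfold)
  also have "\<dots> \<le> (\<Sum>i\<in>{1..N}. R) / (real N)\<^sup>2"
    by (intro divide_right_mono sum_mono row) auto
  also have "\<dots> = R / real N" using N by (simp add: power2_eq_square)
  finally show ?thesis .
qed

section \<open>From correlation bounds to ball sizes\<close>

lemma card_hball_le:
  assumes "i \<in> {1..N}"
  shows "card (hball N E r i) \<le> max_ball_card N E r"
  unfolding max_ball_card_def using assms by (intro Max_ge) auto

lemma max_ball_card_le:
  assumes "1 \<le> N"
  shows "max_ball_card N E r \<le> N"
proof -
  have "card (hball N E r i) \<le> N" for i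
    using card_mono[of "{1..N}" "hball N E r i"] by (simp add: hball_def subset_iff)
  then show ?thesis unfolding max_ball_card_def using assms by (subst Max_le_iff) auto
qed

text \<open>In each row a site of the ball counts at most 1, and any other site at most
  \<open>exp (- t) ^ r\<close> because its distance exceeds \<open>r\<close>.\<close>

lemma mean_sq_overlap_ball_bound:
  assumes model: "mixed_even_model N \<Delta> E \<rho>" and t: "0 \<le> t"
  shows "mean_sq_overlap K N \<Delta> E \<rho> \<beta> t
    \<le> 1 / real N * real (max_ball_card N E r) + exp (- (t * real r))"
proof -
  have N: "0 < N" using model by (simp add: mixed_even_model_def)
  have "mean_sq_overlap K N \<Delta> E \<rho> \<beta> t
      \<le> (real (max_ball_card N E r) + real N * exp (- t) ^ r) / real N"
  proof (rule mean_sq_overlap_le_row[OF model])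
    fix i assume i: "i \<in> {1..N}"
    have "spin_corr K N \<Delta> E \<rho> \<beta> t i j \<le> of_bool (j \<in> hball N E r i) + exp (- t) ^ r"
      if j: "j \<in> {1..N}" for j
    proof (cases "j \<in> hball N E r i")
      case True
      then show ?thesis using spin_corr_le[OF model t i j, of 0 K \<beta>]
        by (simp add: zero_enat_def[symmetric] add_increasing2)
    next
      case False
      with j have "enat r \<le> hdist N E i j" by (auto simp: hball_def)
      from spin_corr_le[OF model t i j this] False show ?thesis by simp
    qed
    then have "(\<Sum>j\<in>{1..N}. spin_corr K N \<Delta> E \<rho> \<beta> t i j)
        \<le> (\<Sum>j\<in>{1..N}. of_bool (j \<in> hball N E r i) + exp (- t) ^ r)"
      by (rule sum_mono)
    also have "\<dots> = real (card ({1..N} \<inter> hball N E r i)) + real N * exp (- t) ^ r"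
      by (simp add: sum.distrib Int_def)
    also have "{1..N} \<inter> hball N E r i = hball N E r i" by (auto simp: hball_def)
    also have "real (card (hball N E r i)) + real N * exp (- t) ^ r
        \<le> real (max_ball_card N E r) + real N * exp (- t) ^ r"
      using card_hball_le[OF i] by simp
    finally show "(\<Sum>j\<in>{1..N}. spin_corr K N \<Delta> E \<rho> \<beta> t i j) \<le> \<dots>" .
  qed
  also have "\<dots> = 1 / real N * real (max_ball_card N E r) + exp (- (t * real r))"
    using N by (simp add: add_divide_distrib exp_of_nat_mult[symmetric] mult.commute)
  finally show ?thesis .
qed

lemma hdist_ge_1:
  assumes "i \<noteq> j"
  shows "1 \<le> hdist N E i j"
proof -
  have "1 \<le> Inf {enat l | l. \<exists>vs es. berge_path N E l i j vs es}"
    by (rule Inf_greatest) (auto simp: berge_path_def one_enat_def)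
  then show ?thesis using assms by (simp add: hdist_def)
qed

text \<open>The left side is largest at \<open>x = 2 * \<theta>\<close>, with value
  \<open>(2 * \<theta>) powr \<theta> * exp (- \<theta>)\<close>; the last factor is
  dropped.\<close>

lemma powr_mult_exp_le:
  fixes x \<theta> :: real
  assumes "0 < x" "0 < \<theta>"
  shows "x powr \<theta> * exp (- x / 2) \<le> (2 * \<theta>) powr \<theta>"
proof -
  have "ln (x / (2 * \<theta>)) \<le> x / (2 * \<theta>) - 1" using assms by (intro ln_le_minus_one) auto
  then have "\<theta> * ln (x / (2 * \<theta>)) \<le> \<theta> * (x / (2 * \<theta>) - 1)"
    using assms by (intro mult_left_mono) auto
  also have "\<dots> = x / 2 - \<theta>" using assms by (simp add: field_simps)
  finally have "\<theta> * ln x - x / 2 \<le> \<theta> * ln (2 * \<theta>)"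
    using assms by (simp add: ln_div right_diff_distrib)
  then show ?thesis using assms by (simp add: powr_def flip: exp_add)
qed

text \<open>Summation by parts: \<open>q\<^sup>d = (1 - q) (q\<^sup>d + q\<^bsup>d+1\<^esup> + \<dots>)\<close> turns the sum of \<open>q\<^sup>d\<close> over distances
  into a sum over ball sizes. Cutting the series at \<open>M\<close> also covers infinite distances.\<close>

lemma spin_corr_le_layers:
  assumes model: "mixed_even_model N \<Delta> E \<rho>" and t: "0 \<le> t"
    and i: "i \<in> {1..N}" and j: "j \<in> {1..N}"
  shows "spin_corr K N \<Delta> E \<rho> \<beta> t i j
    \<le> (1 - exp (- t)) * (\<Sum>r<M. of_bool (j \<in> hball N E r i) * exp (- t) ^ r) + exp (- t) ^ M"
proof (cases "enat M \<le> hdist N E i j")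
  case True
  have "0 \<le> (1 - exp (- t)) * (\<Sum>r<M. of_bool (j \<in> hball N E r i) * exp (- t) ^ r)"
    using t by (intro mult_nonneg_nonneg sum_nonneg) auto
  with spin_corr_le[OF model t i j True, of K \<beta>] show ?thesis by linarith
next
  case False
  then obtain d where d: "hdist N E i j = enat d" "d < M"
    by (cases "hdist N E i j") auto
  have "(\<Sum>r<M. of_bool (j \<in> hball N E r i) * exp (- t) ^ r) = (\<Sum>r<M. if d \<le> r then exp (- t) ^ r else 0)"
    using d j by (intro sum.cong) (auto simp: hball_def)
  also have "\<dots> = (\<Sum>r\<in>{d..<M}. exp (- t) ^ r)"
    by (simp add: sum.If_cases) (rule sum.cong, auto)
  finally have "(1 - exp (- t)) * (\<Sum>r<M. of_bool (j \<in> hball N E r i) * exp (- t) ^ r)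
      = (1 - exp (- t)) * (\<Sum>r\<in>{d..<M}. exp (- t) ^ r)" by simp
  also have "\<dots> = exp (- t) ^ d - exp (- t) ^ M"
  proof -
    have "(1 - q) * (\<Sum>r\<in>{d..<M}. q ^ r) = q ^ d - q ^ M" for q :: real
      using sum_Suc_diff'[of d M "\<lambda>r. - (q ^ r)"] d
      by (simp add: sum_distrib_left algebra_simps)
    then show ?thesis .
  qed
  finally show ?thesis using spin_corr_le[OF model t i j, of d K \<beta>] d by simp
qed

text \<open>The ball bound at a single radius would need \<open>r\<close> of order
  \<open>ln N / t\<close> and lose a power of \<open>ln N\<close>; using all radii at once avoids
  this. The decay \<open>q = p * p\<close> is shared: one factor \<open>p ^ r\<close> absorbs the
  ball size, the other keeps the series summable. The site \<open>i\<close> itself is set apart and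
  yields the term \<open>1 / N\<close>.\<close>

lemma mean_sq_overlap_polynomial_growth:
  assumes model: "mixed_even_model N \<Delta> E \<rho>" and t: "0 < t" and A: "0 < A" and \<theta>: "0 < \<theta>"
    and growth: "\<And>r. 1 \<le> r \<Longrightarrow> real (max_ball_card N E r) \<le> A * real r powr \<theta>"
  shows "mean_sq_overlap K N \<Delta> E \<rho> \<beta> t
    \<le> 1 / real N + (2 * A * (2 * \<theta>) powr \<theta>) / (real N * t powr \<theta>)"
proof -
  define q where "q = exp (- t)"
  define p where "p = exp (- t / 2)"
  define c where "c = (2 * \<theta>) powr \<theta> / t powr \<theta>"
  have q: "0 < q" "q < 1" and p: "0 < p" "p < 1" and qp: "q = p * p"
    using t by (simp_all add: q_def p_def flip: exp_add)
  have c: "0 \<le> c" by (simp add: c_def)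
  have row: "(\<Sum>j\<in>{1..N}. spin_corr K N \<Delta> E \<rho> \<beta> t i j) \<le> 1 + 2 * A * c"
    if i: "i \<in> {1..N}" for i
  proof -
    have le: "(\<Sum>j\<in>{1..N}. spin_corr K N \<Delta> E \<rho> \<beta> t i j) \<le> 1 + 2 * A * c + real N * q ^ M" for M
    proof -
      let ?s = "spin_corr K N \<Delta> E \<rho> \<beta> t i"
      have layer: "(\<Sum>j\<in>{1..N} - {i}. of_bool (j \<in> hball N E r i) * q ^ r) \<le> A * c * p ^ r" for r
      \<comment> \<open>The growth assumption starts at radius 1; the ball of radius 0 contains only
        \<open>i\<close>, which is excluded from this sum.\<close>
      proof (cases "r = 0")
        case True
        have "j \<notin> hball N E 0 i" if "j \<noteq> i" for j
          using hdist_ge_1[of i j N E] that by (auto simp: hball_def zero_enat_def[symmetric])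
        then have "(\<Sum>j\<in>{1..N} - {i}. of_bool (j \<in> hball N E r i) * q ^ r) = 0"
          using True by (intro sum.neutral) auto
        then show ?thesis using A c True by simp
      next
        case False
        have "(\<Sum>j\<in>{1..N} - {i}. of_bool (j \<in> hball N E r i) * q ^ r)
            \<le> (\<Sum>j\<in>{1..N}. of_bool (j \<in> hball N E r i) * q ^ r)"
          using q by (intro sum_mono2) auto
        also have "\<dots> = real (card ({1..N} \<inter> hball N E r i)) * q ^ r"
          by (simp add: Int_def flip: sum_distrib_right)
        also have "{1..N} \<inter> hball N E r i = hball N E r i" by (auto simp: hball_def)
        also have "real (card (hball N E r i)) * q ^ r \<le> A * real r powr \<theta> * q ^ r"
          using card_hball_le[OF i, of E r] growth[of r] False q by (intro mult_right_mono) auto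
        also have "\<dots> \<le> A * c * p ^ r"
        proof -
          have "(t * real r) powr \<theta> * exp (- (t * real r) / 2) \<le> (2 * \<theta>) powr \<theta>"
            using t \<theta> False by (intro powr_mult_exp_le) auto
          also have "exp (- (t * real r) / 2) = p ^ r"
            by (simp add: p_def flip: exp_of_nat_mult)
          also have "(t * real r) powr \<theta> = t powr \<theta> * real r powr \<theta>"
            using t by (simp add: powr_mult)
          finally have "real r powr \<theta> * p ^ r \<le> c"
            using t by (simp add: c_def field_simps)
          then have "A * (real r powr \<theta> * p ^ r) * p ^ r \<le> A * c * p ^ r"
            using A p by (intro mult_right_mono mult_left_mono) auto
          then show ?thesis by (simp add: qp power_mult_distrib mult_ac)
        qed
        finally show ?thesis .
      qed
      have "(\<Sum>j\<in>{1..N} - {i}. ?s j)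
          \<le> (\<Sum>j\<in>{1..N} - {i}. (1 - q) * (\<Sum>r<M. of_bool (j \<in> hball N E r i) * q ^ r) + q ^ M)"
        unfolding q_def using t by (intro sum_mono spin_corr_le_layers[OF model _ i]) auto
      also have "\<dots> = (1 - q) * (\<Sum>r<M. \<Sum>j\<in>{1..N} - {i}. of_bool (j \<in> hball N E r i) * q ^ r)
          + real (card ({1..N} - {i})) * q ^ M"
        by (subst sum.swap) (simp add: sum.distrib sum_distrib_left)
      also have "\<dots> \<le> (1 - q) * (\<Sum>r<M. A * c * p ^ r) + real N * q ^ M"
        using q card_mono[of "{1..N}" "{1..N} - {i}"]
        by (intro add_mono mult_left_mono sum_mono layer mult_right_mono) auto
      \<comment> \<open>The factor \<open>1 - q\<close> cancels the geometric series in
        \<open>p\<close> up to \<open>1 + p\<close>, which is at most 2; thus no further power of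
        \<open>1 / t\<close> appears.\<close>
      also have "(1 - q) * (\<Sum>r<M. A * c * p ^ r) \<le> 2 * A * c"
      proof -
        have "(1 - p) * (\<Sum>r<M. p ^ r) = 1 - p ^ M"
          by (rule one_diff_power_eq[symmetric])
        moreover have "1 - q = (1 + p) * (1 - p)" by (simp add: qp algebra_simps)
        ultimately have "(1 - q) * (\<Sum>r<M. p ^ r) = (1 + p) * (1 - p ^ M)"
          by (simp add: mult.assoc)
        also have "\<dots> \<le> 2 * 1" using p by (intro mult_mono) (auto simp: power_le_one)
        finally have "A * c * ((1 - q) * (\<Sum>r<M. p ^ r)) \<le> A * c * (2 * 1)"
          using A c by (intro mult_left_mono) auto
        then show ?thesis by (simp add: sum_distrib_left[symmetric] mult_ac)
      qed
      finally have "(\<Sum>j\<in>{1..N} - {i}. ?s j) \<le> 2 * A * c + real N * q ^ M" by simp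
      moreover have "?s i \<le> 1"
        using spin_corr_le[OF model less_imp_le[OF t] i i, of 0 K \<beta>]
        by (simp add: zero_enat_def[symmetric])
      ultimately show ?thesis
        using i by (subst sum.remove[of _ i]) auto
    qed
    \<comment> \<open>The truncation level was arbitrary, so letting it tend to infinity removes the
      contribution of far and unreachable sites.\<close>
    have "(\<lambda>M. 1 + 2 * A * c + real N * q ^ M) \<longlonglongrightarrow> 1 + 2 * A * c + real N * 0"
      using q by (intro tendsto_intros LIMSEQ_realpow_zero) simp_all
    then show ?thesis using le by (auto intro: LIMSEQ_le_const)
  qed
  have "mean_sq_overlap K N \<Delta> E \<rho> \<beta> t \<le> (1 + 2 * A * c) / real N"
    by (rule mean_sq_overlap_le_row[OF model row])
  also have "\<dots> = 1 / real N + (2 * A * (2 * \<theta>) powr \<theta>) / (real N * t powr \<theta>)"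
    by (simp add: c_def add_divide_distrib mult.commute)
  finally show ?thesis .
qed

text \<open>In the ball bound \<open>\<gamma> ^ r / N\<close> and \<open>exp (- t * r)\<close>
  balance at the real radius \<open>L = ln N / (t + ln \<gamma>)\<close>, where both equal
  \<open>1 / X\<close>. Rounding \<open>L\<close> up costs a factor \<open>\<gamma>\<close> in the
  first and nothing in the second. The absolute value appears because \<open>A\<close> may have any
  sign.\<close>

lemma mean_sq_overlap_exponential_growth:
  assumes model: "mixed_even_model N \<Delta> E \<rho>" and t: "0 < t" and \<gamma>: "1 < \<gamma>"
    and growth: "\<And>r. 1 \<le> r \<Longrightarrow> real (max_ball_card N E r) \<le> A * \<gamma> ^ r"
  shows "mean_sq_overlap K N \<Delta> E \<rho> \<beta> t \<le> (\<bar>A\<bar> * \<gamma> + 2) / real N powr (t / (t + ln \<gamma>))"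
proof (cases "N = 1")
  \<comment> \<open>For \<open>N = 1\<close> the balancing radius would be 0, outside the growth
    assumption. The ball bound at radius 0 gives 2, which accounts for the summand 2 in the
    constant.\<close>
  case True
  have "mean_sq_overlap K N \<Delta> E \<rho> \<beta> t \<le> 1 / real N * real (max_ball_card N E 0) + exp (- (t * real 0))"
    using t by (intro mean_sq_overlap_ball_bound[OF model]) auto
  also have "\<dots> \<le> 2" using max_ball_card_le[of N E 0] True by simp
  also have "\<dots> \<le> \<bar>A\<bar> * \<gamma> + 2" using \<gamma> by simp
  finally show ?thesis using True by simp
next
  case False
  then have N: "1 < real N" using model by (simp add: mixed_even_model_def)
  define l where "l = ln \<gamma>"
  define L where "L = ln (real N) / (t + l)"
  define r where "r = nat \<lceil>L\<rceil>"
  have l: "0 < l" using \<gamma> by (simp add: l_def)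
  have L: "0 < L" using N t l by (simp add: L_def)
  then have r: "L \<le> real r" "real r \<le> L + 1" "1 \<le> r" unfolding r_def by linarith+
  define X where "X = real N powr (t / (t + l))"
  have X: "X = exp (t * L)" "0 < X" using N by (simp_all add: X_def powr_def L_def)
  have "(t + l) * L = ln (real N)" using t l by (simp add: L_def)
  then have lnN: "ln (real N) = t * L + l * L" by (simp add: distrib_right)
  have "\<gamma> ^ r = exp (l * real r)" using \<gamma> by (simp add: l_def mult.commute[of "ln \<gamma>"] exp_of_nat_mult)
  also have "\<dots> \<le> exp (l * L + l)" using mult_left_mono[OF r(2), of l] l by (simp add: distrib_left)
  also have "\<dots> = \<gamma> * real N / X"
  proof -
    have "exp (l * L) * X = exp (ln (real N))" unfolding X lnN by (simp add: exp_add)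
    then have "exp (l * L) * X = real N" using N by simp
    then show ?thesis using X \<gamma> by (simp add: exp_add l_def field_simps)
  qed
  finally have \<gamma>r: "\<gamma> ^ r \<le> \<gamma> * real N / X" .
  have "mean_sq_overlap K N \<Delta> E \<rho> \<beta> t \<le> 1 / real N * real (max_ball_card N E r) + exp (- (t * real r))"
    using t by (intro mean_sq_overlap_ball_bound[OF model]) auto
  also have "\<dots> \<le> 1 / real N * (\<bar>A\<bar> * (\<gamma> * real N / X)) + 1 / X"
  proof (intro add_mono mult_left_mono)
    have "real (max_ball_card N E r) \<le> A * \<gamma> ^ r" by (rule growth[OF r(3)])
    also have "\<dots> \<le> \<bar>A\<bar> * \<gamma> ^ r" using \<gamma> by (intro mult_right_mono) auto
    also have "\<dots> \<le> \<bar>A\<bar> * (\<gamma> * real N / X)" by (intro mult_left_mono \<gamma>r) auto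
    finally show "real (max_ball_card N E r) \<le> \<bar>A\<bar> * (\<gamma> * real N / X)" .
    show "exp (- (t * real r)) \<le> 1 / X"
      using r t unfolding X by (simp add: exp_minus field_simps)
  qed simp
  also have "\<dots> = (\<bar>A\<bar> * \<gamma> + 1) / X" using N X by (simp add: field_simps)
  also have "\<dots> \<le> (\<bar>A\<bar> * \<gamma> + 2) / X" using X by (intro divide_right_mono) auto
  finally show ?thesis by (simp add: X_def l_def)
qed

theorem theorem1p3:
  shows
    "(\<forall>(N::nat) (\<Delta>::nat) (E::hyperedge set) (\<rho>::nat \<Rightarrow> real \<Rightarrow> real) (\<beta>::ennreal) (t::real)
        (K::perturbation) (r::nat).
        mixed_even_model N \<Delta> E \<rho> \<and> 0 \<le> t \<longrightarrow>
        mean_sq_overlap K N \<Delta> E \<rho> \<beta> t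
          \<le> 1 / real N * real (max_ball_card N E r) + exp (- (t * real r)))
     \<and>
     (\<forall>(A::real) (\<theta>::real). 0 < A \<and> 0 < \<theta> \<longrightarrow>
        (\<exists>C::real. 0 < C \<and>
          (\<forall>(N::nat) (\<Delta>::nat) (E::hyperedge set) (\<rho>::nat \<Rightarrow> real \<Rightarrow> real) (\<beta>::ennreal) (t::real)
             (K::perturbation).
             mixed_even_model N \<Delta> E \<rho> \<and> 0 < t \<and>
             (\<forall>r::nat. 1 \<le> r \<longrightarrow> real (max_ball_card N E r) \<le> A * real r powr \<theta>) \<longrightarrow>
             mean_sq_overlap K N \<Delta> E \<rho> \<beta> t \<le> 1 / real N + C / (real N * t powr \<theta>))))
     \<and>
     (\<forall>(A::real) (\<gamma>::real). 1 < \<gamma> \<longrightarrow>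
        (\<exists>C::real. 0 < C \<and>
          (\<forall>(N::nat) (\<Delta>::nat) (E::hyperedge set) (\<rho>::nat \<Rightarrow> real \<Rightarrow> real) (\<beta>::ennreal) (t::real)
             (K::perturbation).
             mixed_even_model N \<Delta> E \<rho> \<and> 0 < t \<and>
             (\<forall>r::nat. 1 \<le> r \<longrightarrow> real (max_ball_card N E r) \<le> A * \<gamma> ^ r) \<longrightarrow>
             mean_sq_overlap K N \<Delta> E \<rho> \<beta> t \<le> C / real N powr (t / (t + ln \<gamma>)))))"
proof (intro conjI allI impI)
  fix N \<Delta> :: nat and E \<rho> \<beta> and t :: real and K and r :: nat
  assume "mixed_even_model N \<Delta> E \<rho> \<and> 0 \<le> t"
  then show "mean_sq_overlap K N \<Delta> E \<rho> \<beta> t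
      \<le> 1 / real N * real (max_ball_card N E r) + exp (- (t * real r))"
    using mean_sq_overlap_ball_bound by blast
next
  fix A \<theta> :: real
  assume A: "0 < A \<and> 0 < \<theta>"
  show "\<exists>C>0. \<forall>N \<Delta> E \<rho> \<beta> t K. mixed_even_model N \<Delta> E \<rho> \<and> 0 < t \<and>
      (\<forall>r\<ge>1. real (max_ball_card N E r) \<le> A * real r powr \<theta>) \<longrightarrow>
      mean_sq_overlap K N \<Delta> E \<rho> \<beta> t \<le> 1 / real N + C / (real N * t powr \<theta>)"
    using A by (intro exI[of _ "2 * A * (2 * \<theta>) powr \<theta>"] conjI allI impI
        mean_sq_overlap_polynomial_growth) auto
next
  fix A \<gamma> :: real
  assume \<gamma>: "1 < \<gamma>"
  then have "0 < \<bar>A\<bar> * \<gamma> + 2" by (intro add_nonneg_pos) auto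
  with \<gamma> show "\<exists>C>0. \<forall>N \<Delta> E \<rho> \<beta> t K. mixed_even_model N \<Delta> E \<rho> \<and> 0 < t \<and>
      (\<forall>r\<ge>1. real (max_ball_card N E r) \<le> A * \<gamma> ^ r) \<longrightarrow>
      mean_sq_overlap K N \<Delta> E \<rho> \<beta> t \<le> C / real N powr (t / (t + ln \<gamma>))"
    by (intro exI[of _ "\<bar>A\<bar> * \<gamma> + 2"] conjI allI impI mean_sq_overlap_exponential_growth) auto
qed

end
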